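(* There is a polynomial $g_{diff}$ of the system variables such that for every policy $K$ with finite $C(K)$ and every policy $K'$ with $$\|K'-K\|\le\min\left(\frac{\Lambda_{\min}(Q)\,\mu}{4\,C(K)\sum_{i=1}^{N_s}\|B_i\|\,(\|A_i-B_iK_i\|+1)},\ \sum_{i=1}^{N_s}\|K_i\|\right)$$ one has $$\|\nabla C(K')-\nabla C(K)\|\le g_{diff}\,\|K'-K\|.$$
   Context: Setting (a fixed Markovian jump linear system). Let $\Omega=\{1,\dots,N_s\}$ and let $\omega(t)$, $t\ge0$, be a time-homogeneous Markov chain on $\Omega$ with transition probabilities $p_{ij}=\mathbb P(\omega(t+1)=j\mid\omega(t)=i)$ and initial distribution $\pi$. The state $x_t\in\mathbb R^d$ and control $u_t\in\mathbb R^k$ satisfy $x_{t+1}=A_{\omega(t)}x_t+B_{\omega(t)}u_t$, with $A_i\in\mathbb R^{d\times d}$, $B_i\in\mathbb R^{d\times k}$ and $x_0\sim D$ independent of the chain. A policy is a tuple $K=(K_1,\dots,K_{N_s})$, $K_i\in\mathbb R^{k\times d}$, acting by $u_t=-K_{\omega(t)}x_t$; its cost is $C(K)=\mathbb E_{x_0\sim D,\,\omega(0)\sim\pi}\big[\sum_{t=0}^\infty x_t^\top Q_{\omega(t)}x_t+u_t^\top R_{\omega(t)}u_t\big]$. Standing assumptions: all $Q_i\succ0$, all $R_i\succ0$, all $\pi_i>0$, $\mathbb E_{x_0\sim D}[x_0x_0^\top]\succ0$, and the system can be mean-square stabilized. Notation: $\|\cdot\|$ on matrices is the maximal singular value; for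 a tuple $V=(V_1,\dots,V_{N_s})$, $\|V\|=\max_i\|V_i\|$ and $\Lambda_{\min}(V)=\min_i\sigma_{\min}(V_i)$; $\mu=\min_i\pi_i\cdot\sigma_{\min}(\mathbb E_{x_0\sim D}[x_0x_0^\top])$. $\nabla C(K)$ is the gradient of $C$ with respect to the policy, arranged as the block row matrix of the gradients with respect to $K_1,\dots,K_{N_s}$. "System variables" are the quantities $\|A\|,\|B\|,\|Q\|,\|R\|,\|K\|,C(K)/\Lambda_{\min}(Q)$; the coefficients of the polynomial may depend on the fixed system but not on $K,K'$. *)

theory Defs
  imports "HOL-Probability.Probability"
begin

subsection \<open>Matrices and tuples of matrices\<close>

text \<open>
  A \<open>p \<times> q\<close> matrix has type \<open>real^'q^'p\<close>, and a tuple of such matrices indexed by the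
  modes \<open>'s\<close> has type \<open>real^'q^'p^'s\<close>.  The latter is a Euclidean space whose inner product
  is the sum of the Frobenius inner products of the components.
\<close>

definition singular_values :: "real^'q^'p \<Rightarrow> real set" where
  "singular_values M =
     {sqrt l | l. \<exists>v. v \<noteq> 0 \<and> (transpose M ** M) *v v = l *\<^sub>R v}"

definition sigma_max :: "real^'q^'p \<Rightarrow> real" where
  "sigma_max M = Max (singular_values M)"

text \<open>
  Singular values are taken from the eigenvalues of \<open>M\<^sup>T M\<close>; for the minimum this is the
  usual notion when \<open>M\<close> is square, the only case in which it is used.
\<close>

definition sigma_min :: "real^'n^'n \<Rightarrow> real" where
  "sigma_min M = Min (singular_values M)"

definition tuple_norm :: "real^'q^'p^'s::finite \<Rightarrow> real" where
  "tuple_norm V = Max (range (\<lambda>i. sigma_max (V $ i)))"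

definition Lambda_min :: "real^'n^'n^'s::finite \<Rightarrow> real" where
  "Lambda_min V = Min (range (\<lambda>i. sigma_min (V $ i)))"

text \<open>The block row matrix whose blocks, from left to right, are the components of the tuple.\<close>

definition block_row :: "real^'q^'p^'s \<Rightarrow> real^('s \<times> 'q)^'p" where
  "block_row V = (\<chi> a p. V $ fst p $ a $ snd p)"

definition pos_def :: "real^'n^'n \<Rightarrow> bool" where
  "pos_def M \<longleftrightarrow> transpose M = M \<and> (\<forall>x. x \<noteq> 0 \<longrightarrow> x \<bullet> (M *v x) > 0)"


subsection \<open>Markovian jump linear systems\<close>

text \<open>\<open>P $ i $ j\<close> is the probability of a jump from mode \<open>i\<close> to mode \<open>j\<close>.\<close>

definition markov_chain ::
  "'a measure \<Rightarrow> (nat \<Rightarrow> 'a \<Rightarrow> 's::finite) \<Rightarrow> real^'s^'s \<Rightarrow> real^'s \<Rightarrow> bool" where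
  "markov_chain M \<omega> P \<pi> \<longleftrightarrow>
     (\<forall>t. \<omega> t \<in> M \<rightarrow>\<^sub>M count_space UNIV) \<and>
     (\<forall>i j. 0 \<le> P $ i $ j) \<and> (\<forall>i. (\<Sum>j\<in>UNIV. P $ i $ j) = 1) \<and>
     (\<forall>i. \<P>(a in M. \<omega> 0 a = i) = \<pi> $ i) \<and>
     (\<forall>t h j. \<P>(a in M. \<forall>s\<le>t. \<omega> s a = h s) > 0 \<longrightarrow>
        \<P>(a in M. \<omega> (Suc t) a = j \<bar> \<forall>s\<le>t. \<omega> s a = h s) = P $ h t $ j)"

definition second_moment :: "(real^'d) measure \<Rightarrow> real^'d^'d" where
  "second_moment D = (LINT x|D. (\<chi> i j. x $ i * x $ j))"

definition mu :: "(real^'d) measure \<Rightarrow> real^'s::finite \<Rightarrow> real" where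
  "mu D \<pi> = Min (range (\<lambda>i. \<pi> $ i)) * sigma_min (second_moment D)"

definition control :: "real^'d^'k^'s \<Rightarrow> 's \<Rightarrow> real^'d \<Rightarrow> real^'k" where
  "control K i x = - ((K $ i) *v x)"

primrec state ::
  "(nat \<Rightarrow> 'a \<Rightarrow> 's) \<Rightarrow> ('a \<Rightarrow> real^'d) \<Rightarrow> real^'d^'d^'s \<Rightarrow> real^'k^'d^'s \<Rightarrow>
   real^'d^'k^'s \<Rightarrow> nat \<Rightarrow> 'a \<Rightarrow> real^'d" where
  "state \<omega> x0 A B K 0 a = x0 a"
| "state \<omega> x0 A B K (Suc t) a =
     (A $ \<omega> t a) *v state \<omega> x0 A B K t a
     + (B $ \<omega> t a) *v control K (\<omega> t a) (state \<omega> x0 A B K t a)"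

text \<open>
  Mean square stability: \<open>E[\<parallel>x\<^sub>t\<parallel>\<^sup>2 | \<omega>(0) = i] \<rightarrow> 0\<close> for every deterministic initial state and
  every initial mode \<open>i\<close>.
\<close>

definition mean_square_stable ::
  "'a measure \<Rightarrow> (nat \<Rightarrow> 'a \<Rightarrow> 's) \<Rightarrow> real^'d^'d^'s \<Rightarrow> real^'k^'d^'s \<Rightarrow>
   real^'d^'k^'s \<Rightarrow> bool" where
  "mean_square_stable M \<omega> A B K \<longleftrightarrow>
     (\<forall>x i. (\<lambda>t. LINT a|uniform_measure M {a \<in> space M. \<omega> 0 a = i}.
                  (norm (state \<omega> (\<lambda>_. x) A B K t a))\<^sup>2) \<longlonglongrightarrow> 0)"

definition mean_square_stabilizable ::
  "'a measure \<Rightarrow> (nat \<Rightarrow> 'a \<Rightarrow> 's) \<Rightarrow> real^'d^'d^'s \<Rightarrow> real^'k^'d^'s \<Rightarrow> bool" where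
  "mean_square_stabilizable M \<omega> A B \<longleftrightarrow> (\<exists>K. mean_square_stable M \<omega> A B K)"

text \<open>The value \<open>\<infinity>\<close> is allowed; the stage costs are nonnegative when all \<open>Q\<close>, \<open>R\<close> are positive definite.\<close>

definition cost ::
  "'a measure \<Rightarrow> (nat \<Rightarrow> 'a \<Rightarrow> 's) \<Rightarrow> ('a \<Rightarrow> real^'d) \<Rightarrow> real^'d^'d^'s \<Rightarrow> real^'k^'d^'s \<Rightarrow>
   real^'d^'d^'s \<Rightarrow> real^'k^'k^'s \<Rightarrow> real^'d^'k^'s \<Rightarrow> ennreal" where
  "cost M \<omega> x0 A B Q R K =
     (\<integral>\<^sup>+a. (\<Sum>t.
        let i = \<omega> t a; x = state \<omega> x0 A B K t a; u = control K i x
        in ennreal (x \<bullet> ((Q $ i) *v x) + u \<bullet> ((R $ i) *v u))) \<partial>M)"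

text \<open>
  The cost is differentiable at \<open>K\<close> with gradient \<open>G\<close>.  Since \<open>enn2real \<infinity> = 0\<close>, finiteness
  around \<open>K\<close> has to be required separately.
\<close>

definition has_cost_gradient ::
  "'a measure \<Rightarrow> (nat \<Rightarrow> 'a \<Rightarrow> 's::finite) \<Rightarrow> ('a \<Rightarrow> real^'d) \<Rightarrow> real^'d^'d^'s \<Rightarrow> real^'k^'d^'s \<Rightarrow>
   real^'d^'d^'s \<Rightarrow> real^'k^'k^'s \<Rightarrow> real^'d^'k^'s \<Rightarrow> real^'d^'k^'s \<Rightarrow> bool" where
  "has_cost_gradient M \<omega> x0 A B Q R K G \<longleftrightarrow>
     (\<forall>\<^sub>F L in nhds K. cost M \<omega> x0 A B Q R L < \<infinity>) \<and>
     GDERIV (\<lambda>L. enn2real (cost M \<omega> x0 A B Q R L)) K :> G"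

end

theory Submission
  imports Defs
begin

text \<open>
  The second moments \<open>E[x\<^sub>t x\<^sub>t\<^sup>T 1{\<omega>(t) = i}]\<close> evolve linearly, under an operator \<open>T K\<close> that preserves
  positive semidefiniteness, so the cost is \<open>W K \<bullet> chi K\<close> where \<open>chi K\<close> solves \<open>X = X0 + T K X\<close> and
  \<open>W K\<close> collects the stage costs.  If the cost of \<open>K\<close> is finite, the multiple \<open>(2/\<mu>) chi K\<close> is a Lyapunov
  certificate which still decreases along \<open>T K'\<close> for every \<open>K'\<close> within the stated radius.  A certificate
  bounds the resolvent \<open>S = (1 - T)\<^sup>-\<^sup>1\<close> in terms of the cost, hence also \<open>chi\<close>, its dual (the value
  matrices), and by the resolvent identity their increments from \<open>K\<close> to \<open>K'\<close>.  The cost difference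
  identity then gives the derivative of the cost as an expression that is bilinear in these quantities, and
  telescoping it yields the Lipschitz bound.  Every factor is at most a constant multiple of
  \<open>1 + \<parallel>K\<parallel> + C(K)/\<Lambda>\<^sub>m\<^sub>i\<^sub>n(Q)\<close>, so a power of this sum serves as polynomial.
\<close>

subsection \<open>Singular values\<close>

text \<open>The radius comes from the certificate. Since \<open>chi K\<close> -
  \<open>T K (chi K)\<close> = \<open>X0\<close>, and \<open>X0\<close> dominates \<mu> times the
  identity, \<open>chi K\<close> drops by at least \<mu> along \<open>T K\<close>. Replacing K by K'
  changes this by at most 2 x \<sigma> \<delta>, where x is the ratio of the cost to
  \<open>Lambda_min Q\<close>, \<sigma> the sum in the radius and \<delta> the norm of K' - K; the
  factor 4 in the radius makes this at most half of the drop. The 1 added to the closed-loop norm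
  pays for the term quadratic in \<delta>. The second bound in the radius controls the norm of K' by
  that of K. Differentiability rests on exact algebra: the operator and the stage weights are
  quadratic in the policy, so all remainders are explicit and of second order in \<delta>. The
  exponent 13 is that of the worst term, for instance value matrices (4) times derivative of the
  operator (3) times increment of \<open>chi\<close> (6).\<close>

lemma inner_matrix_vector: "x \<bullet> ((M::real^'n^'m) *v y) = (x v* M) \<bullet> y"
  by (simp add: dot_lmul_matrix)

text \<open>Along the line v + t w the form is 2 t b + t^2 c without constant term, which stays
  nonnegative for all t only if b = 0.\<close>

lemma psd_kernel:
  fixes N :: "real^'n^'n"
  assumes sym: "transpose N = N" and nn: "\<And>w. 0 \<le> w \<bullet> (N *v w)" and z: "v \<bullet> (N *v v) = 0"
  shows "N *v v = 0"
proof -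
  have "w \<bullet> (N *v v) = 0" for w
  proof -
    define b where "b = w \<bullet> (N *v v)"
    define c where "c = w \<bullet> (N *v w)"
    have "v \<bullet> (N *v w) = w \<bullet> (N *v v)"
      using dot_lmul_matrix[of v N w] sym by (metis inner_commute transpose_matrix_vector)
    then have q: "0 \<le> 2 * t * b + t\<^sup>2 * c" for t
      using nn[of "v + t *\<^sub>R w"] z
      by (simp add: b_def c_def matrix_vector_right_distrib matrix_vector_mult_scaleR
          inner_add_left inner_add_right power2_eq_square algebra_simps)
    have c: "c \<ge> 0" using nn c_def by simp
    \<comment> \<open>The minimizer would be t = -b/c; the denominator c + 1 still gives a negative
      value unless b = 0, and it covers c = 0.\<close>
    have "0 \<le> 2 * (- (b / (c + 1))) * b + (- (b / (c + 1)))\<^sup>2 * c" by (rule q)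
    also have "\<dots> = - (b\<^sup>2 * (c + 2) / (c + 1)\<^sup>2)"
    proof -
      have "c + 1 \<noteq> 0" using c by simp
      then show ?thesis by (simp add: divide_simps power2_eq_square) (simp add: algebra_simps)
    qed
    finally have "b\<^sup>2 * (c + 2) / (c + 1)\<^sup>2 \<le> 0" by simp
    then have "b\<^sup>2 \<le> 0" using c by (simp add: divide_le_0_iff mult_le_0_iff)
    then show ?thesis by (simp add: b_def)
  qed
  then show ?thesis by (metis inner_eq_zero_iff)
qed

text \<open>The Rayleigh quotient attains its minimum l on the compact unit sphere. Subtracting l
  times the identity leaves a nonnegative form that vanishes at the minimizer, so
  \<open>psd_kernel\<close> makes it an eigenvector.\<close>

lemma symmetric_min_eigenvector:
  fixes N :: "real^'n^'n"
  assumes sym: "transpose N = N"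
  obtains v l where "norm v = 1" "N *v v = l *\<^sub>R v" "\<And>w. l * (w \<bullet> w) \<le> w \<bullet> (N *v w)"
proof -
  have "continuous_on (sphere 0 1) (\<lambda>v. v \<bullet> (N *v v))"
    by (intro continuous_intros)
  moreover have "sphere (0::real^'n) 1 \<noteq> {}" by simp
  ultimately obtain v where v: "norm v = 1"
    and min: "\<And>w. norm w = 1 \<Longrightarrow> v \<bullet> (N *v v) \<le> w \<bullet> (N *v w)"
    using continuous_attains_inf[of "sphere 0 1" "\<lambda>v. v \<bullet> (N *v v)"] by auto
  define l where "l = v \<bullet> (N *v v)"
  have l: "l * (w \<bullet> w) \<le> w \<bullet> (N *v w)" for w
  proof (cases "w = 0")
    case False
    then have "l \<le> (w /\<^sub>R norm w) \<bullet> (N *v (w /\<^sub>R norm w))"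
      unfolding l_def by (intro min) simp
    also have "\<dots> = (w \<bullet> (N *v w)) / (w \<bullet> w)"
      by (simp add: matrix_vector_mult_scaleR dot_square_norm power2_eq_square divide_inverse)
    finally show ?thesis using False by (simp add: field_simps)
  qed simp
  have vm: "(N - l *\<^sub>R mat 1) *v w = N *v w - l *\<^sub>R w" for w
    by (simp add: matrix_vector_mult_diff_rdistrib flip: scaleR_matrix_vector_assoc)
  have tr: "transpose (N - l *\<^sub>R mat 1) = N - l *\<^sub>R mat 1"
    using sym by (auto simp: vec_eq_iff transpose_def mat_def)
  have "(N - l *\<^sub>R mat 1) *v v = 0"
  proof (rule psd_kernel[OF tr])
    show "0 \<le> w \<bullet> ((N - l *\<^sub>R mat 1) *v w)" for w
      using l[of w] by (simp add: vm inner_diff_right)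
    show "v \<bullet> ((N - l *\<^sub>R mat 1) *v v) = 0"
      unfolding vm inner_diff_right using v by (simp add: l_def dot_square_norm)
  qed
  then have "N *v v = l *\<^sub>R v" by (simp add: vm)
  with v l show ?thesis using that by blast
qed

text \<open>Eigenvectors for distinct eigenvalues are orthogonal, and pairwise orthogonal families
  are finite. Finiteness gives \<open>Max\<close> and \<open>Min\<close> over singular values their
  meaning.\<close>

lemma finite_eigenvalues_symmetric:
  fixes N :: "real^'n^'n"
  assumes sym: "transpose N = N"
  shows "finite {l. \<exists>v. v \<noteq> 0 \<and> N *v v = l *\<^sub>R v}"
proof -
  let ?E = "{l. \<exists>v. v \<noteq> 0 \<and> N *v v = l *\<^sub>R v}"
  have "\<forall>l\<in>?E. \<exists>v. v \<noteq> 0 \<and> N *v v = l *\<^sub>R v" by blast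
  from bchoice[OF this] obtain e where e: "\<And>l. l \<in> ?E \<Longrightarrow> e l \<noteq> 0 \<and> N *v e l = l *\<^sub>R e l"
    by blast
  have orth: "e l \<bullet> e m = 0" if "l \<in> ?E" "m \<in> ?E" "l \<noteq> m" for l m
  proof -
    have "e l \<bullet> (N *v e m) = (N *v e l) \<bullet> e m"
      using dot_lmul_matrix[of "e l" N "e m"] sym by (metis transpose_matrix_vector)
    then show ?thesis using e that by simp
  qed
  have inj: "inj_on e ?E"
  proof (rule inj_onI, rule ccontr)
    fix l m assume "l \<in> ?E" "m \<in> ?E" "e l = e m" "l \<noteq> m"
    then have "e l \<bullet> e l = 0" using orth[of l m] by simp
    then show False using e[OF \<open>l \<in> ?E\<close>] by simp
  qed
  have "pairwise orthogonal (e ` ?E)"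
    unfolding pairwise_def orthogonal_def using orth by blast
  then have "finite (e ` ?E)" by (rule pairwise_orthogonal_imp_finite)
  with inj show ?thesis using finite_imageD by blast
qed

lemma transpose_gram: "transpose (transpose M ** M) = transpose M ** (M::real^'q^'p)"
  by (simp add: matrix_transpose_mul)

lemma inner_gram: "w \<bullet> ((transpose M ** M) *v v) = (M *v w) \<bullet> ((M::real^'q^'p) *v v)"
  using dot_lmul_matrix[of w "transpose M" "M *v v"] by (simp add: matrix_vector_mul_assoc del: transpose_matrix_vector)

lemma finite_singular_values: "finite (singular_values (M::real^'q^'p))"
proof -
  have "singular_values M = sqrt ` {l. \<exists>v. v \<noteq> 0 \<and> (transpose M ** M) *v v = l *\<^sub>R v}"
    unfolding singular_values_def by auto
  then show ?thesis using finite_imageI[OF finite_eigenvalues_symmetric[OF transpose_gram[of M]]] by simp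
qed

lemma singular_value_eq:
  assumes "s \<in> singular_values (M::real^'q^'p)"
  obtains v where "v \<noteq> 0" "norm (M *v v) = s * norm v" "s \<ge> 0"
proof -
  from assms obtain l v where s: "s = sqrt l" and v: "v \<noteq> 0" "(transpose M ** M) *v v = l *\<^sub>R v"
    unfolding singular_values_def by auto
  have "l * (norm v)\<^sup>2 = (norm (M *v v))\<^sup>2"
    using inner_gram[of v M v] v by (simp add: dot_square_norm)
  moreover from this have "l \<ge> 0" using v(1)
    by (metis zero_le_power2 zero_le_mult_iff zero_less_norm_iff zero_less_power not_le)
  ultimately have "(s * norm v)\<^sup>2 = (norm (M *v v))\<^sup>2" "s \<ge> 0" by (simp_all add: s power_mult_distrib)
  then have "norm (M *v v) = s * norm v" by (simp add: power2_eq_iff_nonneg)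
  with v(1) \<open>s \<ge> 0\<close> show ?thesis using that by blast
qed

text \<open>The minimal eigenvalue of the negated Gram matrix is minus the maximal one of the Gram
  matrix, so its variational bound is the operator norm estimate. Its eigenvector also shows that
  the set of singular values is nonempty.\<close>

lemma sigma_max_attained:
  fixes M :: "real^'q^'p"
  shows "sigma_max M \<in> singular_values M" and "norm (M *v w) \<le> sigma_max M * norm w"
proof -
  let ?N = "- (transpose M ** M)"
  have tr: "transpose ?N = ?N"
    using transpose_gram[of M] by (auto simp: vec_eq_iff transpose_def)
  have neg: "?N *v w = - ((transpose M ** M) *v w)" for w
    using matrix_vector_mult_diff_rdistrib[of 0 "transpose M ** M" w] by simp
  obtain v l where v: "norm v = 1" "?N *v v = l *\<^sub>R v" "\<And>w. l * (w \<bullet> w) \<le> w \<bullet> (?N *v w)"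
    using symmetric_min_eigenvector[OF tr] by blast
  have "(transpose M ** M) *v v = (- l) *\<^sub>R v" using v(2) neg by (metis minus_minus scaleR_left.minus)
  then have mem: "sqrt (- l) \<in> singular_values M"
    unfolding singular_values_def using v(1) norm_zero by (metis (mono_tags, lifting) mem_Collect_eq zero_neq_one)
  then show "sigma_max M \<in> singular_values M"
    unfolding sigma_max_def using finite_singular_values Max_in by fast
  have le: "sqrt (- l) \<le> sigma_max M"
    unfolding sigma_max_def by (rule Max_ge[OF finite_singular_values mem])
  have "(norm (M *v w))\<^sup>2 \<le> - l * (norm w)\<^sup>2"
    using v(3)[of w] neg[of w] inner_gram[of w M w] by (simp add: dot_square_norm)
  then have "norm (M *v w) \<le> sqrt (- l) * norm w"
    by (metis norm_ge_zero real_le_rsqrt real_sqrt_abs abs_norm_cancel real_sqrt_mult)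
  also have "\<dots> \<le> sigma_max M * norm w" using le by (simp add: mult_right_mono)
  finally show "norm (M *v w) \<le> sigma_max M * norm w" .
qed

lemma sigma_max_nonneg: "0 \<le> sigma_max (M::real^'q^'p)"
  by (meson sigma_max_attained(1) singular_value_eq)

text \<open>The transposed action is bounded by the singular value of M itself: pair
  \<open>w v* M\<close> with itself, move M to the other side and cancel one factor.\<close>

lemma norm_vector_matrix_le: "norm (w v* (M::real^'q^'p)) \<le> sigma_max M * norm w"
proof (cases "w v* M = 0")
  case False
  have "(norm (w v* M))\<^sup>2 = w \<bullet> (M *v (w v* M))"
    by (simp add: dot_square_norm[symmetric] dot_lmul_matrix)
  also have "\<dots> \<le> norm w * (sigma_max M * norm (w v* M))"
    by (meson norm_cauchy_schwarz order_trans mult_left_mono norm_ge_zero sigma_max_attained(2))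
  finally have "norm (w v* M) * norm (w v* M) \<le> (sigma_max M * norm w) * norm (w v* M)"
    by (simp add: power2_eq_square algebra_simps)
  then show ?thesis using False by simp
qed (simp add: sigma_max_nonneg)

lemma abs_entry_le_sigma_max: "\<bar>(M::real^'q^'p) $ i $ j\<bar> \<le> sigma_max M"
proof -
  have "\<bar>M $ i $ j\<bar> = \<bar>(M *v axis j 1) $ i\<bar>" by (simp add: matrix_vector_mult_basis column_def)
  also have "\<dots> \<le> norm (M *v axis j 1)" by (rule component_le_norm_cart)
  also have "\<dots> \<le> sigma_max M" using sigma_max_attained(2)[of M "axis j 1"] by simp
  finally show ?thesis .
qed

lemma norm_matrix_vector_le: "norm ((M::real^'q^'p) *v v) \<le> norm M * norm v"
proof -
  have "norm (M *v v) = L2_set (\<lambda>i. norm ((M *v v) $ i)) UNIV" by (simp add: norm_vec_def)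
  also have "\<dots> \<le> L2_set (\<lambda>i. norm (M $ i) * norm v) UNIV"
    by (rule L2_set_mono) (auto simp: matrix_vector_mul_component Cauchy_Schwarz_ineq2)
  also have "\<dots> = norm M * norm v"
    by (simp add: norm_vec_def[of M] L2_set_left_distrib)
  finally show ?thesis .
qed

lemma sigma_max_le_norm: "sigma_max (M::real^'q^'p) \<le> norm M"
proof -
  obtain v where "v \<noteq> 0" "norm (M *v v) = sigma_max M * norm v"
    using sigma_max_attained(1) singular_value_eq by metis
  then show ?thesis using norm_matrix_vector_le[of M v] by simp
qed

text \<open>The smallest eigenvalue l of M is itself a singular value, so \<open>sigma_min M\<close>
  is at most l and inherits the lower bound of the form. It is positive because it is attained at a
  vector that M does not kill.\<close>

lemma sigma_min_pos_def:
  fixes M :: "real^'n^'n"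
  assumes "pos_def M"
  shows "0 < sigma_min M" and "sigma_min M * (v \<bullet> v) \<le> v \<bullet> (M *v v)"
proof -
  have tr: "transpose M = M" and pd: "\<And>x. x \<noteq> 0 \<Longrightarrow> x \<bullet> (M *v x) > 0"
    using assms by (auto simp: pos_def_def)
  obtain u l where u: "norm u = 1" "M *v u = l *\<^sub>R u" "\<And>w. l * (w \<bullet> w) \<le> w \<bullet> (M *v w)"
    using symmetric_min_eigenvector[OF tr] by blast
  have u0: "u \<noteq> 0" using u(1) by auto
  have l: "l > 0" using pd[OF u0] u(1,2) by (simp add: dot_square_norm)
  have "(transpose M ** M) *v u = (l * l) *\<^sub>R u"
    using tr u(2) by (simp add: matrix_vector_mult_scaleR flip: matrix_vector_mul_assoc
        del: transpose_matrix_vector)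
  then have "sqrt (l * l) \<in> singular_values M" unfolding singular_values_def using u0 by blast
  then have mem: "l \<in> singular_values M" using l by simp
  then have "sigma_min M \<in> singular_values M"
    unfolding sigma_min_def using finite_singular_values Min_in by fast
  then obtain w where w: "w \<noteq> 0" "norm (M *v w) = sigma_min M * norm w" "sigma_min M \<ge> 0"
    using singular_value_eq by metis
  have "M *v w \<noteq> 0" using pd[OF w(1)] by auto
  then show "0 < sigma_min M" using w by (cases "sigma_min M = 0") auto
  have "sigma_min M \<le> l" unfolding sigma_min_def by (rule Min_le[OF finite_singular_values mem])
  then show "sigma_min M * (v \<bullet> v) \<le> v \<bullet> (M *v v)"
    using u(3)[of v] by (meson inner_ge_zero mult_right_mono order_trans)
qed

lemma tuple_norm_ge: "sigma_max ((V::real^'q^'p^'s::finite) $ i) \<le> tuple_norm V"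
  unfolding tuple_norm_def by (rule Max_ge) auto

lemma tuple_norm_nonneg: "0 \<le> tuple_norm (V::real^'q^'p^'s::finite)"
  using tuple_norm_ge sigma_max_nonneg order_trans by blast

lemma tuple_norm_le_norm: "tuple_norm (V::real^'q^'p^'s::finite) \<le> norm V"
proof -
  have "tuple_norm V \<in> range (\<lambda>i. sigma_max (V $ i))"
    unfolding tuple_norm_def by (rule Max_in) auto
  then obtain i where "tuple_norm V = sigma_max (V $ i)" by blast
  also have "\<dots> \<le> norm (V $ i)" by (rule sigma_max_le_norm)
  also have "\<dots> \<le> norm V" by (rule Finite_Cartesian_Product.norm_nth_le)
  finally show ?thesis .
qed

lemma norm_le_tuple_norm:
  "norm (V::real^'q^'p^'s::finite) \<le> real (CARD('s) * CARD('p) * CARD('q)) * tuple_norm V"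
proof -
  have "norm V \<le> (\<Sum>i\<in>UNIV. norm (V $ i))" by (simp add: norm_vec_def L2_set_le_sum)
  also have "\<dots> \<le> (\<Sum>i\<in>UNIV. \<Sum>a\<in>UNIV. norm (V $ i $ a))"
    by (intro sum_mono) (simp add: norm_vec_def L2_set_le_sum)
  also have "\<dots> \<le> (\<Sum>i\<in>(UNIV::'s set). \<Sum>a\<in>(UNIV::'p set). \<Sum>b\<in>(UNIV::'q set). \<bar>V $ i $ a $ b\<bar>)"
    by (intro sum_mono norm_le_l1_cart)
  also have "\<dots> \<le> (\<Sum>i\<in>(UNIV::'s set). \<Sum>a\<in>(UNIV::'p set). \<Sum>b\<in>(UNIV::'q set). tuple_norm V)"
    by (intro sum_mono) (meson abs_entry_le_sigma_max tuple_norm_ge order_trans)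
  finally show ?thesis by simp
qed

lemma norm_block_row: "norm (block_row (V::real^'q^'p^'s::finite)) \<le> 
   real (CARD('s) * CARD('p) * CARD('q)) * norm V"
proof -
  have "norm (block_row V) \<le> (\<Sum>a\<in>UNIV. norm (block_row V $ a))" by (simp add: norm_vec_def L2_set_le_sum)
  also have "\<dots> \<le> (\<Sum>a\<in>(UNIV::'p set). \<Sum>b\<in>(UNIV::('s\<times>'q) set). \<bar>block_row V $ a $ b\<bar>)"
    by (intro sum_mono norm_le_l1_cart)
  also have "\<dots> \<le> (\<Sum>a\<in>(UNIV::'p set). \<Sum>b\<in>(UNIV::('s\<times>'q) set). norm V)"
  proof (intro sum_mono)
    fix a :: 'p and b :: "'s \<times> 'q"
    have "\<bar>V $ fst b $ a $ snd b\<bar> \<le> norm (V $ fst b $ a)" by (rule component_le_norm_cart)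
    also have "\<dots> \<le> norm (V $ fst b)" by (rule Finite_Cartesian_Product.norm_nth_le)
    also have "\<dots> \<le> norm V" by (rule Finite_Cartesian_Product.norm_nth_le)
    finally show "\<bar>block_row V $ a $ b\<bar> \<le> norm V" by (simp add: block_row_def)
  qed
  finally show ?thesis by (simp add: algebra_simps)
qed

lemma Lambda_min_pos_def:
  fixes Q :: "real^'n^'n^'s::finite"
  assumes "\<And>i. pos_def (Q $ i)"
  shows "0 < Lambda_min Q" and "Lambda_min Q * (v \<bullet> v) \<le> v \<bullet> (Q $ i *v v)"
proof -
  have "Lambda_min Q \<in> range (\<lambda>i. sigma_min (Q $ i))" unfolding Lambda_min_def by (rule Min_in) auto
  then obtain j where "Lambda_min Q = sigma_min (Q $ j)" by blast
  then show "0 < Lambda_min Q" using sigma_min_pos_def(1)[OF assms] by simp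
  have "Lambda_min Q \<le> sigma_min (Q $ i)" unfolding Lambda_min_def by (rule Min_le) auto
  then show "Lambda_min Q * (v \<bullet> v) \<le> v \<bullet> (Q $ i *v v)"
    using sigma_min_pos_def(2)[OF assms[of i], of v]
      mult_right_mono[of "Lambda_min Q" "sigma_min (Q $ i)" "v \<bullet> v"] by simp
qed

lemma norm_transpose: "norm (transpose (M::real^'q^'p)) = norm M"
  unfolding norm_vec_def L2_set_def transpose_def
  by (simp add: sum_nonneg real_sqrt_pow2) (rule sum.swap)

lemma norm_matrix_mult_le: "norm ((M::real^'q^'p) ** (N::real^'r^'q)) \<le> norm M * norm N"
proof -
  have row: "(M ** N) $ i = transpose N *v (M $ i)" for i
    by (simp add: vec_eq_iff matrix_matrix_mult_def vector_matrix_mult_def mult.commute)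
  have "norm (M ** N) = L2_set (\<lambda>i. norm ((M ** N) $ i)) UNIV" by (simp add: norm_vec_def)
  also have "\<dots> \<le> L2_set (\<lambda>i. norm (M $ i) * norm N) UNIV"
  proof (rule L2_set_mono)
    show "norm ((M ** N) $ i) \<le> norm (M $ i) * norm N" for i
      using norm_matrix_vector_le[of "transpose N" "M $ i"]
      by (simp add: row norm_transpose mult.commute del: transpose_matrix_vector)
  qed simp
  also have "\<dots> = norm M * norm N"
    by (simp add: norm_vec_def[of M] L2_set_left_distrib)
  finally show ?thesis .
qed

subsection \<open>The second moment operator\<close>

lemma bounded_bilinear_matrix_mult:
  "bounded_bilinear (\<lambda>(X::real^'q^'p) (Y::real^'r^'q). X ** Y)"
proof
  show "(X + X') ** Y = X ** Y + X' ** (Y::real^'r^'q)" for X X' :: "real^'q^'p" and Y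
    by (vector matrix_matrix_mult_def sum.distrib[symmetric] field_simps)
  show "X ** (Y + Y') = X ** Y + X ** (Y'::real^'r^'q)" for X :: "real^'q^'p" and Y Y'
    by (rule matrix_add_ldistrib)
  show "(r *\<^sub>R X) ** Y = r *\<^sub>R (X ** (Y::real^'r^'q))" for r and X :: "real^'q^'p" and Y
    by (vector matrix_matrix_mult_def sum_distrib_left mult.assoc)
  show "X ** (r *\<^sub>R Y) = r *\<^sub>R (X ** (Y::real^'r^'q))" for r and X :: "real^'q^'p" and Y
    by (vector matrix_matrix_mult_def sum_distrib_left mult.left_commute)
  show "\<exists>C. \<forall>(X::real^'q^'p) (Y::real^'r^'q). norm (X ** Y) \<le> norm X * norm Y * C"
    using norm_matrix_mult_le by (intro exI[of _ 1]) auto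
qed

interpretation mm: bounded_bilinear "\<lambda>(X::real^'q^'p) (Y::real^'r^'q). X ** Y"
  by (rule bounded_bilinear_matrix_mult)

lemma bounded_linear_transpose: "bounded_linear (transpose :: real^'q^'p \<Rightarrow> real^'p^'q)"
proof (rule bounded_linear_intro[where K=1])
  show "transpose (X + Y) = transpose X + transpose Y" for X Y :: "real^'q^'p"
    by (simp add: vec_eq_iff transpose_def)
qed (simp_all add: transpose_scalar norm_transpose)

lemmas transpose_add = linear_add[OF bounded_linear.linear[OF bounded_linear_transpose]]
lemmas transpose_sum = linear_sum[OF bounded_linear.linear[OF bounded_linear_transpose]]

section \<open>Quadratic forms, symmetrization and the order they induce on tuples\<close>

definition quad :: "real^'n^'n \<Rightarrow> real^'n \<Rightarrow> real"
  where "quad X v = v \<bullet> (X *v v)"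

lemma quad_add: "quad (X + Y) v = quad X v + quad Y v"
  by (simp add: quad_def matrix_vector_mult_add_rdistrib inner_add_right)

lemma quad_diff: "quad (X - Y) v = quad X v - quad Y v"
  by (simp add: quad_def matrix_vector_mult_diff_rdistrib inner_diff_right)

lemma quad_scaleR: "quad (r *\<^sub>R X) v = r * quad X v"
  by (simp add: quad_def flip: scaleR_matrix_vector_assoc)

lemma quad_zero: "quad 0 v = 0"
  by (simp add: quad_def)

lemma quad_sum: "quad (\<Sum>i\<in>I. f i) v = (\<Sum>i\<in>I. quad (f i) v)"
  by (induction I rule: infinite_finite_induct) (simp_all add: quad_add quad_zero)

lemma quad_transpose: "quad (transpose X) v = quad X v"
  by (simp add: quad_def inner_matrix_vector inner_commute)

lemma quad_mat_1: "quad (mat 1) v = v \<bullet> v"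
  by (simp add: quad_def)

lemma inner_congruence:
  "v \<bullet> ((U ** X ** transpose (V::real^'n^'m)) *v w) = (v v* U) \<bullet> (X *v (w v* V))"
  for U :: "real^'n^'m"
  by (simp add: dot_lmul_matrix flip: matrix_vector_mul_assoc)

lemma quad_congruence: "quad (L ** X ** transpose (L::real^'n^'m)) v = quad X (v v* L)"
  by (simp add: quad_def inner_congruence)

lemma abs_quad_le_norm: "\<bar>quad X v\<bar> \<le> norm X * (v \<bullet> v)"
proof -
  have "\<bar>quad X v\<bar> \<le> norm v * norm (X *v v)" unfolding quad_def by (rule Cauchy_Schwarz_ineq2)
  also have "\<dots> \<le> norm v * (norm X * norm v)"
    by (simp add: mult_left_mono norm_matrix_vector_le)
  finally show ?thesis by (simp add: dot_square_norm power2_eq_square algebra_simps)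
qed

text \<open>Polarize X and apply the parallelogram law to N. Symmetry of X enters because its form
  does not see an antisymmetric part.\<close>

lemma polarization_bound:
  assumes sym: "transpose X = X" and le: "\<And>v. \<bar>quad X v\<bar> \<le> quad N v"
  shows "\<bar>a \<bullet> (X *v b)\<bar> \<le> (quad N a + quad N b) / 2"
proof -
  have s: "b \<bullet> (X *v a) = a \<bullet> (X *v b)"
    using sym by (metis dot_lmul_matrix inner_commute transpose_matrix_vector)
  have "4 * (a \<bullet> (X *v b)) = quad X (a + b) - quad X (a - b)"
    using s by (simp add: quad_def algebra_simps inner_simps)
  moreover have "quad N (a + b) + quad N (a - b) = 2 * (quad N a + quad N b)"
    by (simp add: quad_def algebra_simps inner_simps)
  ultimately show ?thesis using le[of "a + b"] le[of "a - b"] by linarith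
qed

definition sym_part :: "real^'n^'n \<Rightarrow> real^'n^'n"
  where "sym_part X = (1/2) *\<^sub>R (X + transpose X)"

lemma quad_sym_part: "quad (sym_part X) v = quad X v"
  by (simp add: sym_part_def quad_scaleR quad_add quad_transpose)

lemma transpose_sym_part: "transpose (sym_part X) = sym_part X"
  by (simp add: sym_part_def transpose_scalar transpose_add add.commute)

lemma sym_part_id: "transpose X = X \<Longrightarrow> sym_part X = X"
  by (simp add: sym_part_def flip: scaleR_2)

lemma sym_part_add: "sym_part (X + Y) = sym_part X + sym_part Y"
  by (simp add: sym_part_def transpose_add scaleR_add_right)

lemma sym_part_scaleR: "sym_part (r *\<^sub>R X) = r *\<^sub>R sym_part X"
  by (simp add: sym_part_def transpose_scalar scaleR_add_right)

lemma norm_sym_part_le: "norm (sym_part X) \<le> norm X"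
  using norm_triangle_ineq[of X "transpose X"] by (simp add: sym_part_def norm_transpose)

text \<open>A condition on quadratic forms alone, symmetry not included; \<open>psd (Y - X)\<close>
  serves as the order "X below Y" throughout.\<close>

definition psd :: "real^'n^'n^'s \<Rightarrow> bool"
  where "psd X \<longleftrightarrow> (\<forall>i v. 0 \<le> quad (X $ i) v)"

lemma psd_add: "psd X \<Longrightarrow> psd Y \<Longrightarrow> psd (X + Y)"
  by (simp add: psd_def quad_add)

lemma psd_scaleR: "0 \<le> r \<Longrightarrow> psd X \<Longrightarrow> psd (r *\<^sub>R X)"
  by (simp add: psd_def quad_scaleR)

definition id_tuple :: "real^'n^'n^'s"
  where "id_tuple = (\<chi> i. mat 1)"

lemma id_tuple_nth [simp]: "id_tuple $ i = mat 1"
  by (simp add: id_tuple_def)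

lemma psd_id_tuple: "psd id_tuple"
  by (simp add: psd_def quad_mat_1)

lemma inner_id_tuple:
  fixes N :: "real^'n^'n^'s"
  shows "id_tuple \<bullet> N = (\<Sum>i\<in>UNIV. \<Sum>a\<in>UNIV. quad (N $ i) (axis a 1))"
proof -
  have "mat 1 \<bullet> (M::real^'n^'n) = (\<Sum>a\<in>UNIV. quad M (axis a 1))" for M
    unfolding quad_def matrix_vector_mult_basis inner_vec_def mat_def
    by (simp add: axis_def column_def if_distrib[of "\<lambda>x. x * _"] cong: if_cong)
  then show ?thesis by (subst inner_vec_def) simp
qed

lemma trace_nonneg: "psd N \<Longrightarrow> 0 \<le> id_tuple \<bullet> N"
  by (simp add: inner_id_tuple psd_def sum_nonneg)

lemma id_tuple_inner_self: "1 \<le> id_tuple \<bullet> (id_tuple :: real^'n^'n^'s)"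
proof -
  have "id_tuple \<bullet> (id_tuple :: real^'n^'n^'s) = real (CARD('s) * CARD('n))"
    by (subst inner_id_tuple) (simp add: quad_mat_1)
  moreover have "1 \<le> CARD('s) * CARD('n)" by (simp add: Suc_leI)
  ultimately show ?thesis by linarith
qed

text \<open>Polarization bounds entry (a, b) by half the sum of the diagonal entries of N at a and
  b; summing over both indices counts each diagonal entry CARD('n) times.\<close>

lemma norm_le_trace:
  fixes X N :: "real^'n^'n^'s"
  assumes sym: "\<And>i. transpose (X $ i) = X $ i"
    and le: "\<And>i v. \<bar>quad (X $ i) v\<bar> \<le> quad (N $ i) v"
  shows "norm X \<le> real CARD('n) * (id_tuple \<bullet> N)"
proof -
  have "norm X \<le> (\<Sum>i\<in>UNIV. norm (X $ i))" by (simp add: norm_vec_def L2_set_le_sum)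
  also have "\<dots> \<le> (\<Sum>i\<in>UNIV. \<Sum>a\<in>UNIV. norm (X $ i $ a))"
    by (intro sum_mono) (simp add: norm_vec_def L2_set_le_sum)
  also have "\<dots> \<le> (\<Sum>i\<in>UNIV. \<Sum>a\<in>UNIV. \<Sum>b\<in>UNIV. \<bar>X $ i $ a $ b\<bar>)"
    by (intro sum_mono norm_le_l1_cart)
  also have "\<dots> \<le> (\<Sum>i\<in>UNIV. \<Sum>a\<in>UNIV. \<Sum>b\<in>UNIV.
      (quad (N $ i) (axis a 1) + quad (N $ i) (axis b 1)) / 2)"
  proof (intro sum_mono)
    fix i :: 's and a b :: 'n
    have "X $ i $ a $ b = axis a 1 \<bullet> (X $ i *v axis b 1)"
      by (simp add: matrix_vector_mult_basis column_def inner_axis')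
    then show "\<bar>X $ i $ a $ b\<bar> \<le> (quad (N $ i) (axis a 1) + quad (N $ i) (axis b 1)) / 2"
      using polarization_bound[OF sym le] by metis
  qed
  also have "\<dots> = real CARD('n) * (id_tuple \<bullet> N)"
    by (simp add: inner_id_tuple sum.distrib flip: sum_divide_distrib)
      (simp add: sum_distrib_left sum_distrib_right mult_ac)
  finally show ?thesis .
qed

section \<open>The jump operator, its positivity and its resolvent\<close>

locale mjls =
  fixes P :: "real^'s^'s" and A :: "real^'d^'d^'s" and B :: "real^'k^'d^'s"
    and Q :: "real^'d^'d^'s" and R :: "real^'k^'k^'s"
  assumes P_nonneg: "0 \<le> P $ i $ j" and P_sum: "(\<Sum>j\<in>UNIV. P $ i $ j) = 1"
begin

text \<open>Two gains U and V make the expression linear in each of them: \<open>T K\<close> takes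
  both equal, while its increments and its derivative arise by replacing one gain at a time.\<close>

definition jump :: "real^'d^'d^'s \<Rightarrow> real^'d^'d^'s \<Rightarrow> real^'d^'d^'s \<Rightarrow> real^'d^'d^'s" where
  "jump U V X = (\<chi> j. \<Sum>i\<in>UNIV. P $ i $ j *\<^sub>R (U $ i ** sym_part (X $ i) ** transpose (V $ i)))"

definition input_gain :: "real^'d^'k^'s \<Rightarrow> real^'d^'d^'s" where
  "input_gain H = (\<chi> i. B $ i ** H $ i)"

definition closed_loop :: "real^'d^'k^'s \<Rightarrow> real^'d^'d^'s" where
  "closed_loop K = A - input_gain K"

text \<open>Through \<open>jump\<close> the operator discards the antisymmetric parts of its argument, so that its
  powers are controlled by quadratic forms on the whole space and not only on symmetric tuples.\<close>

definition T :: "real^'d^'k^'s \<Rightarrow> real^'d^'d^'s \<Rightarrow> real^'d^'d^'s" where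
  "T K X = jump (closed_loop K) (closed_loop K) X"

definition control_weight :: "real^'d^'k^'s \<Rightarrow> real^'d^'k^'s \<Rightarrow> real^'d^'d^'s" where
  "control_weight U V = (\<chi> i. transpose (U $ i) ** R $ i ** V $ i)"

definition W :: "real^'d^'k^'s \<Rightarrow> real^'d^'d^'s" where
  "W K = Q + control_weight K K"

lemma jump_nth:
  "jump U V X $ j = (\<Sum>i\<in>UNIV. P $ i $ j *\<^sub>R (U $ i ** sym_part (X $ i) ** transpose (V $ i)))"
  by (simp add: jump_def)

lemma jump_add:
  "jump (U + U') V X = jump U V X + jump U' V X"
  "jump U (V + V') X = jump U V X + jump U V' X"
  "jump U V (X + X') = jump U V X + jump U V X'"
  by (subst vec_eq_iff, simp add: jump_nth sym_part_add mm.add_left mm.add_right transpose_add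
      scaleR_add_right sum.distrib)+

lemma jump_scaleR:
  "jump (r *\<^sub>R U) V X = r *\<^sub>R jump U V X"
  "jump U (r *\<^sub>R V) X = r *\<^sub>R jump U V X"
  "jump U V (r *\<^sub>R X) = r *\<^sub>R jump U V X"
  by (subst vec_eq_iff, simp add: jump_nth sym_part_scaleR mm.scaleR_left mm.scaleR_right transpose_scalar
      scaleR_sum_right mult.commute)+

text \<open>The transition probabilities out of a mode sum to one, so the number of source modes is
  the only factor left.\<close>

lemma norm_jump_le: "norm (jump U V X) \<le> real CARD('s) * norm U * norm V * norm X"
proof -
  have "norm (jump U V X) \<le> (\<Sum>j\<in>UNIV. norm (jump U V X $ j))"
    by (simp add: norm_vec_def[of "jump U V X"] L2_set_le_sum)
  also have "\<dots> \<le> (\<Sum>j\<in>UNIV. \<Sum>i\<in>UNIV. P $ i $ j * (norm U * norm V * norm X))"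
  proof (intro sum_mono)
    fix j
    have "norm (P $ i $ j *\<^sub>R (U $ i ** sym_part (X $ i) ** transpose (V $ i)))
        \<le> P $ i $ j * (norm U * norm V * norm X)" for i
    proof -
      have "norm (U $ i ** sym_part (X $ i) ** transpose (V $ i))
          \<le> norm (U $ i ** sym_part (X $ i)) * norm (transpose (V $ i))"
        by (rule norm_matrix_mult_le)
      also have "\<dots> \<le> norm (U $ i) * norm (sym_part (X $ i)) * norm (V $ i)"
        unfolding norm_transpose by (intro mult_right_mono norm_matrix_mult_le norm_ge_zero)
      also have "norm (sym_part (X $ i)) \<le> norm X"
        by (rule order_trans[OF norm_sym_part_le Finite_Cartesian_Product.norm_nth_le])
      then have "norm (U $ i) * norm (sym_part (X $ i)) * norm (V $ i) \<le> norm U * norm X * norm V"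
        by (intro mult_mono Finite_Cartesian_Product.norm_nth_le mult_nonneg_nonneg norm_ge_zero)
      finally have "norm (U $ i ** sym_part (X $ i) ** transpose (V $ i)) \<le> norm U * norm V * norm X"
        by (simp add: mult_ac)
      from mult_left_mono[OF this P_nonneg[of i j]] show ?thesis using P_nonneg[of i j] by simp
    qed
    then show "norm (jump U V X $ j) \<le> (\<Sum>i\<in>UNIV. P $ i $ j * (norm U * norm V * norm X))"
      unfolding jump_nth by (intro sum_norm_le)
  qed
  also have "\<dots> = (\<Sum>i\<in>UNIV. (\<Sum>j\<in>UNIV. P $ i $ j) * (norm U * norm V * norm X))"
    by (subst sum.swap) (simp add: sum_distrib_right)
  finally show ?thesis by (simp add: P_sum algebra_simps)
qed

lemma bounded_linear_jump: "bounded_linear (jump U V)"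
  by (rule bounded_linear_intro[where K="real CARD('s) * norm U * norm V"])
    (use norm_jump_le[of U V] in \<open>simp_all add: jump_add jump_scaleR mult_ac\<close>)

lemma bounded_linear_T: "bounded_linear (T K)"
  unfolding T_def by (rule bounded_linear_jump)

lemma linear_T_pow: "linear (T K ^^ t)"
proof (induction t)
  case 0
  then show ?case by (simp add: linear_iff)
next
  case (Suc t)
  then show ?case using linear_compose[OF Suc bounded_linear.linear[OF bounded_linear_T]]
    by (simp add: comp_def)
qed

lemma quad_T: "quad (T K X $ j) v = (\<Sum>i\<in>UNIV. P $ i $ j * quad (X $ i) (v v* closed_loop K $ i))"
  by (simp add: T_def jump_nth quad_sum quad_scaleR quad_congruence quad_sym_part)

lemma transpose_T: "transpose (T K X $ j) = T K X $ j"
  by (simp add: T_def jump_nth transpose_sum transpose_scalar matrix_transpose_mul transpose_sym_part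
      matrix_mul_assoc)

lemma psd_T: "psd X \<Longrightarrow> psd (T K X)"
  by (simp add: psd_def quad_T sum_nonneg P_nonneg)

lemma psd_T_pow: "psd X \<Longrightarrow> psd ((T K ^^ t) X)"
  by (induction t) (simp_all add: psd_T)

text \<open>The trace of the Neumann series applied to the identity, bounded through partial sums so
  that no value is assigned to a divergent series. By positivity this one scalar bound controls the
  powers of \<open>T K\<close> on every tuple.\<close>

definition stable :: "real^'d^'k^'s \<Rightarrow> real \<Rightarrow> bool" where
  "stable K s \<longleftrightarrow> (\<forall>n. (\<Sum>t<n. id_tuple \<bullet> (T K ^^ t) id_tuple) \<le> s)"

text \<open>Apply \<open>T K\<close> to the inequality for n and add the decrease of one step: Y
  dominates its n-th image plus the partial sum of the series. Dropping the image, which is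
  positive, and taking traces bounds the partial sums.\<close>

lemma stable_of_certificate:
  assumes Y: "psd Y" and dec: "psd (Y - T K Y - id_tuple)"
  shows "stable K (id_tuple \<bullet> Y)"
  unfolding stable_def
proof
  fix n
  interpret T: bounded_linear "T K" by (rule bounded_linear_T)
  have step: "psd (Y - (T K ^^ n) Y - (\<Sum>t<n. (T K ^^ t) id_tuple))"
  proof (induction n)
    case 0
    then show ?case by (simp add: psd_def quad_zero)
  next
    case (Suc n)
    have "psd ((Y - T K Y - id_tuple) + T K (Y - (T K ^^ n) Y - (\<Sum>t<n. (T K ^^ t) id_tuple)))"
      using dec psd_T[OF Suc] by (rule psd_add)
    then show ?case
      by (simp only: sum.lessThan_Suc_shift) (simp add: T.diff T.add T.sum algebra_simps)
  qed
  have "psd (Y - (\<Sum>t<n. (T K ^^ t) id_tuple))"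
    using psd_add[OF step psd_T_pow[OF Y, of n K]] by (simp add: algebra_simps)
  then show "(\<Sum>t<n. id_tuple \<bullet> (T K ^^ t) id_tuple) \<le> id_tuple \<bullet> Y"
    using trace_nonneg by (fastforce simp: inner_diff_right inner_sum_right)
qed

text \<open>Z lies between plus and minus its norm times the identity. Powers of \<open>T K\<close>
  preserve this, and \<open>norm_le_trace\<close> turns it back into a norm bound.\<close>

lemma norm_T_pow_le:
  "norm ((T K ^^ t) Z) \<le> real CARD('d) * norm Z * (id_tuple \<bullet> (T K ^^ t) id_tuple)"
proof (cases t)
  case 0
  \<comment> \<open>The zeroth power is separate because Z itself may fail to be symmetric, whereas
    every value of \<open>T K\<close> is symmetric.\<close>
  have "1 \<le> real CARD('d)" by (simp add: Suc_leI)
  then have "1 * norm Z * 1 \<le> real CARD('d) * norm Z * (id_tuple \<bullet> (id_tuple :: real^'d^'d^'s))"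
    by (intro mult_mono id_tuple_inner_self) auto
  with 0 show ?thesis by simp
next
  case (Suc t')
  let ?p = "T K ^^ t"
  interpret p: linear ?p by (rule linear_T_pow)
  have le: "\<bar>quad (Z $ i) v\<bar> \<le> norm Z * quad (id_tuple $ i) v" for i v
    using abs_quad_le_norm[of "Z $ i" v] mult_right_mono[OF Finite_Cartesian_Product.norm_nth_le[of Z i], of "v \<bullet> v"]
    by (simp add: quad_mat_1)
  have "0 \<le> quad ((norm Z *\<^sub>R id_tuple - Z) $ i) v" "0 \<le> quad ((norm Z *\<^sub>R id_tuple + Z) $ i) v" for i v
    using le[of i v] by (simp_all add: quad_diff quad_add quad_scaleR abs_le_iff)
  then have "psd (norm Z *\<^sub>R id_tuple - Z)" "psd (norm Z *\<^sub>R id_tuple + Z)"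
    unfolding psd_def by blast+
  then have "psd (?p (norm Z *\<^sub>R id_tuple - Z))" "psd (?p (norm Z *\<^sub>R id_tuple + Z))"
    by (blast intro: psd_T_pow)+
  then have "\<bar>quad (?p Z $ i) v\<bar> \<le> quad ((norm Z *\<^sub>R ?p id_tuple) $ i) v" for i v
    unfolding psd_def p.diff p.add p.scaleR vector_add_component vector_minus_component quad_diff quad_add
    by (smt (verit))
  moreover have "transpose (?p Z $ i) = ?p Z $ i" for i using Suc by (simp add: transpose_T)
  ultimately have "norm (?p Z) \<le> real CARD('d) * (id_tuple \<bullet> (norm Z *\<^sub>R ?p id_tuple))"
    by (intro norm_le_trace)
  then show ?thesis by (simp add: algebra_simps)
qed

lemma T_pow_summable:
  assumes "stable K s"
  shows "summable (\<lambda>t. norm ((T K ^^ t) Z))"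
    and "(\<Sum>t. norm ((T K ^^ t) Z)) \<le> real CARD('d) * s * norm Z"
proof -
  have le: "(\<Sum>t<n. norm ((T K ^^ t) Z)) \<le> real CARD('d) * s * norm Z" for n
  proof -
    have "(\<Sum>t<n. norm ((T K ^^ t) Z))
        \<le> (\<Sum>t<n. real CARD('d) * norm Z * (id_tuple \<bullet> (T K ^^ t) id_tuple))"
      by (intro sum_mono norm_T_pow_le)
    also have "\<dots> = real CARD('d) * norm Z * (\<Sum>t<n. id_tuple \<bullet> (T K ^^ t) id_tuple)"
      by (simp add: sum_distrib_left)
    also have "\<dots> \<le> real CARD('d) * norm Z * s"
      using assms by (intro mult_left_mono) (auto simp: stable_def)
    finally show ?thesis by (simp add: algebra_simps)
  qed
  then show summable: "summable (\<lambda>t. norm ((T K ^^ t) Z))"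
    by (intro summableI_nonneg_bounded) auto
  show "(\<Sum>t. norm ((T K ^^ t) Z)) \<le> real CARD('d) * s * norm Z"
    by (rule suminf_le_const[OF summable le])
qed

text \<open>The Neumann series for the inverse of 1 - \<open>T K\<close>; its properties are stated
  for stable K, where the series converges.\<close>

definition S :: "real^'d^'k^'s \<Rightarrow> real^'d^'d^'s \<Rightarrow> real^'d^'d^'s" where
  "S K Z = (\<Sum>t. (T K ^^ t) Z)"

context
  fixes K s assumes st: "stable K s"
begin

lemma summable_T_pow: "summable (\<lambda>t. (T K ^^ t) Z)"
  by (rule summable_norm_cancel[OF T_pow_summable(1)[OF st]])

lemma norm_S_le: "norm (S K Z) \<le> real CARD('d) * s * norm Z"
  unfolding S_def using summable_norm[OF T_pow_summable(1)[OF st]] T_pow_summable(2)[OF st]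
  by (rule order_trans)

lemma S_fixpoint: "S K Z = Z + T K (S K Z)"
proof -
  interpret T: bounded_linear "T K" by (rule bounded_linear_T)
  have "S K Z = Z + (\<Sum>t. (T K ^^ Suc t) Z)"
    unfolding S_def using suminf_split_head[OF summable_T_pow, of Z] by simp
  also have "(\<Sum>t. (T K ^^ Suc t) Z) = T K (S K Z)"
    unfolding S_def using T.suminf[OF summable_T_pow, of Z] by simp
  finally show ?thesis .
qed

lemma linear_S: "linear (S K)"
proof (rule linearI)
  show "S K (Y + Z) = S K Y + S K Z" for Y Z
    unfolding S_def using suminf_add[OF summable_T_pow summable_T_pow, of Y Z]
    by (simp add: linear_add[OF linear_T_pow])
  show "S K (r *\<^sub>R Z) = r *\<^sub>R S K Z" for r Z
    unfolding S_def using suminf_scaleR_right[OF summable_T_pow, of r Z]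
    by (simp add: linear_scale[OF linear_T_pow])
qed

text \<open>\<open>S_fixpoint\<close> gives a right inverse of 1 - \<open>T K\<close>. Commuting
  \<open>T K\<close> with the series makes it a left inverse as well, which is what turns residuals
  into bounds on increments.\<close>

lemma S_residual: "S K (Z - T K Z) = Z"
proof -
  have "S K (T K Z) = T K (S K Z)"
  proof -
    interpret T: bounded_linear "T K" by (rule bounded_linear_T)
    show ?thesis unfolding S_def using T.suminf[OF summable_T_pow, of Z]
      by (simp add: funpow_swap1)
  qed
  then show ?thesis using S_fixpoint[of Z] linear_diff[OF linear_S, of Z "T K Z"]
    by (metis add_diff_cancel_right')
qed

end

end

subsection \<open>Second moments of the controlled chain\<close>

definition outer :: "real^'p \<Rightarrow> real^'q \<Rightarrow> real^'q^'p"
  where "outer u v = (\<chi> i j. u $ i * v $ j)"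

text \<open>The form becomes linear in \<open>outer v v\<close>, so expectations of forms reduce to
  second moments.\<close>

lemma quad_outer: "quad Y v = Y \<bullet> outer v v"
  by (simp add: quad_def inner_vec_def matrix_vector_mult_def outer_def sum_distrib_left mult_ac)

lemma quad_axis_outer: "quad (axis i (outer v v) $ j) w = (if j = i then (v \<bullet> w)\<^sup>2 else 0)"
proof -
  have "quad (outer v v) w = (v \<bullet> w)\<^sup>2"
    by (simp add: quad_def outer_def matrix_vector_mult_def inner_vec_def power2_eq_square
        sum_product sum_distrib_left mult_ac)
  then show ?thesis by (simp add: axis_def quad_zero)
qed

lemma matrix_mult_outer: "M ** outer u v = outer (M *v u) v"
  by (simp add: vec_eq_iff matrix_matrix_mult_def matrix_vector_mult_def outer_def
      sum_distrib_right mult.assoc)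

lemma outer_mult_transpose: "outer u v ** transpose M = outer u (M *v v)"
  by (simp add: vec_eq_iff matrix_matrix_mult_def matrix_vector_mult_def outer_def transpose_def
      sum_distrib_left mult_ac)

lemma norm_outer: "norm (outer u v) = norm u * norm v"
proof -
  have row: "outer u v $ i = u $ i *\<^sub>R v" for i by (simp add: vec_eq_iff outer_def)
  show ?thesis by (simp add: norm_vec_def[of "outer u v"] row norm_vec_def[of u] L2_set_left_distrib)
qed

lemma continuous_outer: "continuous_on UNIV (\<lambda>x. outer x x)"
  unfolding outer_def by (intro continuous_intros)

lemma quad_matrix_vector: "quad Y (M *v v) = Y \<bullet> (M ** outer v v ** transpose M)"
  by (simp add: quad_outer matrix_mult_outer outer_mult_transpose)

lemma bounded_linear_sandwich:
  fixes M :: "real^'q^'p" and N :: "real^'r^'m"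
  shows "bounded_linear (\<lambda>X. Y \<bullet> (M ** X ** transpose N))"
  by (rule bounded_linear_compose[OF bounded_linear_inner_right
        bounded_linear_compose[OF mm.bounded_linear_left mm.bounded_linear_right]])

locale mjls_process = prob_space M + mjls P A B Q R
  for M :: "'a measure"
    and P :: "real^'s^'s" and A :: "real^'d^'d^'s" and B :: "real^'k^'d^'s"
    and Q :: "real^'d^'d^'s" and R :: "real^'k^'k^'s" +
  fixes \<omega> :: "nat \<Rightarrow> 'a \<Rightarrow> 's" and x0 :: "'a \<Rightarrow> real^'d"
    and D :: "(real^'d) measure" and \<pi> :: "real^'s"
  assumes chain: "markov_chain M \<omega> P \<pi>"
    and x0_measurable: "x0 \<in> borel_measurable M" and distr_x0: "distr M borel x0 = D"
    and indep: "indep_set (sets (vimage_algebra (space M) x0 borel))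
           (sets (vimage_algebra (space M) (\<lambda>a t. \<omega> t a)
                    (Pi\<^sub>M UNIV (\<lambda>_::nat. count_space (UNIV :: 's set)))))"
    and Q_pos: "\<And>i. pos_def (Q $ i)" and R_pos: "\<And>i. pos_def (R $ i)"
    and \<pi>_pos: "\<And>i. \<pi> $ i > 0"
    and square_integrable: "integrable D (\<lambda>x. (norm x)\<^sup>2)"
    and second_moment_pos: "pos_def (second_moment D)"
begin

section \<open>Mode paths, their probabilities and the state along a path\<close>

lemma \<omega>_measurable: "\<omega> t \<in> M \<rightarrow>\<^sub>M count_space UNIV"
  using chain by (auto simp: markov_chain_def)

text \<open>The modes up to time \<open>t\<close>, most recent first.\<close>

primrec hist :: "nat \<Rightarrow> 'a \<Rightarrow> 's list" where
  "hist 0 a = [\<omega> 0 a]"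
| "hist (Suc t) a = \<omega> (Suc t) a # hist t a"

lemma length_hist: "length (hist t a) = Suc t"
  by (induction t) auto

lemma hd_hist: "hd (hist t a) = \<omega> t a"
  by (cases t) auto

lemma hist_nonempty: "hist t a \<noteq> []"
  by (cases t) auto

lemma nth_hist: "k \<le> t \<Longrightarrow> hist t a ! k = \<omega> (t - k) a"
  by (induction t arbitrary: k) (auto simp: nth_Cons split: nat.split)

text \<open>Histories run backwards in time, so the mode at time s sits at position t - s; in this
  form the event matches the one in \<open>markov_chain\<close>.\<close>

lemma hist_eq_iff:
  assumes "length l = Suc t"
  shows "hist t a = l \<longleftrightarrow> (\<forall>s\<le>t. \<omega> s a = l ! (t - s))"
proof -
  have "hist t a = l \<longleftrightarrow> (\<forall>k<Suc t. hist t a ! k = l ! k)"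
    using assms by (auto simp: list_eq_iff_nth_eq length_hist)
  also have "\<dots> \<longleftrightarrow> (\<forall>k\<le>t. \<omega> (t - k) a = l ! k)"
    by (auto simp: nth_hist less_Suc_eq_le)
  also have "\<dots> \<longleftrightarrow> (\<forall>s\<le>t. \<omega> s a = l ! (t - s))"
    by (metis diff_diff_cancel diff_le_self)
  finally show ?thesis .
qed

lemma hist_event: "{a \<in> space M. hist t a = l} \<in> events"
proof (induction t arbitrary: l)
  case 0
  have "{a \<in> space M. hist 0 a = l} = (if l = [] then {} else
     if tl l = [] then {a \<in> space M. \<omega> 0 a = hd l} else {})"
    by (cases l) auto
  then show ?case using \<omega>_measurable[of 0] by auto
next
  case (Suc t)
  have "{a \<in> space M. hist (Suc t) a = l} = (if l = [] then {} else
     {a \<in> space M. \<omega> (Suc t) a = hd l} \<inter> {a \<in> space M. hist t a = tl l})"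
    by (cases l) auto
  then show ?case using \<omega>_measurable[of "Suc t"] Suc.IH by auto
qed

definition path_prob :: "nat \<Rightarrow> 's list \<Rightarrow> real" where
  "path_prob t l = \<P>(a in M. hist t a = l)"

lemma path_prob_0: "path_prob 0 [i] = \<pi> $ i"
  using chain by (simp add: path_prob_def markov_chain_def)

text \<open>The Markov property speaks only of histories of positive probability; on a null history
  both sides vanish.\<close>

lemma path_prob_Suc:
  assumes l: "length l = Suc t"
  shows "path_prob (Suc t) (j # l) = P $ hd l $ j * path_prob t l"
proof -
  let ?H = "\<lambda>a. \<forall>s\<le>t. \<omega> s a = l ! (t - s)"
  have H: "hist t a = l \<longleftrightarrow> ?H a" for a by (rule hist_eq_iff[OF l])
  have prH: "path_prob t l = \<P>(a in M. ?H a)" by (simp add: path_prob_def H)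
  have prS: "path_prob (Suc t) (j # l) = \<P>(a in M. \<omega> (Suc t) a = j \<and> ?H a)" by (simp add: path_prob_def H)
  show ?thesis
  proof (cases "\<P>(a in M. ?H a) > 0")
    case True
    have markov: "\<forall>t h j. 0 < \<P>(a in M. \<forall>s\<le>t. \<omega> s a = h s) \<longrightarrow>
        \<P>(a in M. \<omega> (Suc t) a = j \<bar> \<forall>s\<le>t. \<omega> s a = h s) = P $ h t $ j"
      using chain by (simp add: markov_chain_def)
    have "\<P>(a in M. \<omega> (Suc t) a = j \<bar> ?H a) = P $ (l ! (t - t)) $ j"
      by (rule markov[rule_format, OF True])
    moreover have "l ! 0 = hd l" using l by (cases l) auto
    ultimately show ?thesis using True by (simp add: prH prS cond_prob_def field_simps)
  next
    case False
    then have z: "path_prob t l = 0" unfolding prH by (simp add: zero_less_measure_iff)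
    have "path_prob (Suc t) (j # l) \<le> path_prob t l"
      unfolding path_prob_def by (rule finite_measure_mono) (use hist_event in auto)
    then show ?thesis using z by (simp add: path_prob_def measure_le_0_iff)
  qed
qed

text \<open>The head of the list is the current mode, which has not yet acted on the current state.
  Hence the head is ignored and a singleton list gives the identity.\<close>

primrec propagator :: "real^'d^'k^'s \<Rightarrow> 's list \<Rightarrow> real^'d^'d" where
  "propagator K [] = mat 1"
| "propagator K (j # l) = (if l = [] then mat 1 else closed_loop K $ hd l ** propagator K l)"

lemma state_eq: "state \<omega> x0 A B K t a = propagator K (hist t a) *v x0 a"
proof (induction t)
  case (Suc t)
  have "state \<omega> x0 A B K (Suc t) a = closed_loop K $ \<omega> t a *v state \<omega> x0 A B K t a"
    by (simp add: control_def closed_loop_def input_gain_def matrix_vector_mult_diff_rdistrib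
        flip: matrix_vector_mul_assoc)
      (simp add: linear_neg[OF matrix_vector_mul_linear])
  then show ?case
    by (simp add: Suc hist_nonempty hd_hist matrix_vector_mul_assoc)
qed simp

lemma sets_D: "sets D = sets borel"
  using distr_x0 by (metis sets_distr)

lemma integrable_outer: "integrable D (\<lambda>x. outer x x)"
proof (rule Bochner_Integration.integrable_bound[OF square_integrable])
  have "(\<lambda>x::real^'d. outer x x) \<in> borel_measurable borel"
    by (rule borel_measurable_continuous_onI[OF continuous_outer])
  then show "(\<lambda>x. outer x x) \<in> borel_measurable D"
    using measurable_cong_sets[OF sets_D refl] by blast
qed (simp add: norm_outer power2_eq_square)

lemma second_moment_eq: "second_moment D = (LINT x|D. outer x x)"
  by (simp add: second_moment_def outer_def)

lemma expectation_quad: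
  "integrable M (\<lambda>a. quad Y (F *v x0 a))"
  "expectation (\<lambda>a. quad Y (F *v x0 a)) = Y \<bullet> (F ** second_moment D ** transpose F)"
proof -
  let ?b = "\<lambda>X. Y \<bullet> (F ** X ** transpose F)"
  interpret b: bounded_linear ?b by (rule bounded_linear_sandwich)
  have i: "integrable (distr M borel x0) (\<lambda>x. ?b (outer x x))"
    using integrable_bounded_linear[OF bounded_linear_sandwich integrable_outer] distr_x0 by simp
  show "integrable M (\<lambda>a. quad Y (F *v x0 a))"
    using integrable_distr[OF x0_measurable i] by (simp add: quad_matrix_vector)
  have "expectation (\<lambda>a. ?b (outer (x0 a) (x0 a))) = (LINT x|D. ?b (outer x x))"
    unfolding distr_x0[symmetric]
    by (rule integral_distr[symmetric, OF x0_measurable]) (use i in auto)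
  also have "\<dots> = ?b (second_moment D)"
    unfolding second_moment_eq by (rule integral_bounded_linear[OF bounded_linear_sandwich integrable_outer])
  finally show "expectation (\<lambda>a. quad Y (F *v x0 a)) = ?b (second_moment D)"
    by (simp add: quad_matrix_vector)
qed

text \<open>The sigma-algebras generated by the two real functions lie inside the two that are
  independent by assumption.\<close>

lemma indep_x0_path:
  fixes f g :: "_ \<Rightarrow> real"
  assumes f: "f \<in> borel_measurable borel"
    and g: "g \<in> borel_measurable (Pi\<^sub>M UNIV (\<lambda>_::nat. count_space (UNIV :: 's set)))"
  shows "indep_var borel (\<lambda>a. f (x0 a)) borel (\<lambda>a. g (\<lambda>t. \<omega> t a))"
proof -
  let ?N = "Pi\<^sub>M UNIV (\<lambda>_::nat. count_space (UNIV :: 's set))"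
  let ?F = "vimage_algebra (space M) x0 borel"
  let ?G = "vimage_algebra (space M) (\<lambda>a t. \<omega> t a) ?N"
  have path: "(\<lambda>a t. \<omega> t a) \<in> M \<rightarrow>\<^sub>M ?N"
    by (rule measurable_PiM_single') (use \<omega>_measurable in auto)
  have fF: "(\<lambda>a. f (x0 a)) \<in> ?F \<rightarrow>\<^sub>M borel"
    by (rule measurable_compose[OF measurable_vimage_algebra1 f]) auto
  have gG: "(\<lambda>a. g (\<lambda>t. \<omega> t a)) \<in> ?G \<rightarrow>\<^sub>M borel"
    by (rule measurable_compose[OF measurable_vimage_algebra1 g]) (auto simp: space_PiM)
  have sF: "sigma_sets (space M) {(\<lambda>a. f (x0 a)) -` S \<inter> space M |S. S \<in> sets borel} \<subseteq> sets ?F"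
    using sets.sigma_sets_subset[of "{(\<lambda>a. f (x0 a)) -` S \<inter> space M |S. S \<in> sets borel}" ?F]
      measurable_sets[OF fF] by auto
  have sG: "sigma_sets (space M) {(\<lambda>a. g (\<lambda>t. \<omega> t a)) -` S \<inter> space M |S. S \<in> sets borel} \<subseteq> sets ?G"
    using sets.sigma_sets_subset[of "{(\<lambda>a. g (\<lambda>t. \<omega> t a)) -` S \<inter> space M |S. S \<in> sets borel}" ?G]
      measurable_sets[OF gG] by auto
  have "indep_set (sigma_sets (space M) {(\<lambda>a. f (x0 a)) -` S \<inter> space M |S. S \<in> sets borel})
    (sigma_sets (space M) {(\<lambda>a. g (\<lambda>t. \<omega> t a)) -` S \<inter> space M |S. S \<in> sets borel})"
    using indep unfolding indep_set_def
    by (rule indep_sets_mono_sets) (use sF sG in \<open>auto split: bool.split\<close>)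
  then show ?thesis
    unfolding indep_var_eq
    using measurable_compose[OF x0_measurable f] measurable_compose[OF path g] by simp
qed

text \<open>The history event is a cylinder in the path space, so its indicator is independent of
  \<open>x0\<close> and the expectation factors.\<close>

lemma expectation_hist:
  assumes l: "length l = Suc t"
  shows "integrable M (\<lambda>a. quad Y (F *v x0 a) * indicator {a. hist t a = l} a)"
    and "expectation (\<lambda>a. quad Y (F *v x0 a) * indicator {a. hist t a = l} a)
      = Y \<bullet> (F ** second_moment D ** transpose F) * path_prob t l"
proof -
  let ?N = "Pi\<^sub>M UNIV (\<lambda>_::nat. count_space (UNIV :: 's set))"
  let ?E = "{f \<in> space ?N. \<forall>s\<in>{..t}. f s = l ! (t - s)}"
  have E: "?E \<in> sets ?N" by measurable
  have q: "(\<lambda>x. quad Y (F *v x)) \<in> borel_measurable borel"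
    unfolding quad_matrix_vector
    by (intro borel_measurable_continuous_onI
        continuous_on_compose2[OF linear_continuous_on[OF bounded_linear_sandwich] continuous_outer]) auto
  have comp: "(indicator ?E \<circ> (\<lambda>a t. \<omega> t a)) = (indicator {a. hist t a = l} :: 'a \<Rightarrow> real)"
    by (auto simp: indicator_def hist_eq_iff[OF l] space_PiM fun_eq_iff)
  have iv: "indep_var borel (\<lambda>a. quad Y (F *v x0 a)) borel (indicator {a. hist t a = l})"
    using indep_x0_path[OF q borel_measurable_indicator[OF E]] comp by (simp add: comp_def)
  have ind: "expectation (indicator {a. hist t a = l}) = path_prob t l"
    by (simp add: path_prob_def Int_def conj_commute)
  have int: "integrable M (indicator {a. hist t a = l} :: 'a \<Rightarrow> real)"
    using integrable_real_indicator[OF hist_event, of t l]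
    by (rule Bochner_Integration.integrable_cong[THEN iffD1, rotated -1])
      (auto simp: indicator_def emeasure_eq_measure)
  show "integrable M (\<lambda>a. quad Y (F *v x0 a) * indicator {a. hist t a = l} a)"
    by (rule indep_var_integrable[OF iv expectation_quad(1) int])
  show "expectation (\<lambda>a. quad Y (F *v x0 a) * indicator {a. hist t a = l} a)
      = Y \<bullet> (F ** second_moment D ** transpose F) * path_prob t l"
    using indep_var_lebesgue_integral[OF iv expectation_quad(1) int]
    by (simp only: expectation_quad(2) ind)
qed

section \<open>Second moments as powers of the operator, and the cost as a series\<close>

definition X0 :: "real^'d^'d^'s" where
  "X0 = (\<chi> i. \<pi> $ i *\<^sub>R second_moment D)"

abbreviation paths :: "nat \<Rightarrow> 's list set" where
  "paths t \<equiv> {l. length l = Suc t}"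

lemma finite_paths: "finite (paths t)"
  using finite_lists_length_eq[of "UNIV :: 's set" "Suc t"] by simp

lemma sum_paths_Suc: "(\<Sum>l\<in>paths (Suc t). f l) = (\<Sum>l\<in>paths t. \<Sum>j\<in>UNIV. f (j # l))"
proof -
  have "paths (Suc t) = (\<lambda>(l, j). j # l) ` (paths t \<times> UNIV)"
    by (auto simp: length_Suc_conv image_iff)
  moreover have "inj_on (\<lambda>(l, j). j # l) (paths t \<times> UNIV)" by (auto simp: inj_on_def)
  ultimately show ?thesis by (simp add: sum.reindex sum.cartesian_product case_prod_unfold)
qed

definition path_moment :: "real^'d^'k^'s \<Rightarrow> 's list \<Rightarrow> real^'d^'d" where
  "path_moment K l = propagator K l ** second_moment D ** transpose (propagator K l)"

lemma transpose_path_moment: "transpose (path_moment K l) = path_moment K l"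
  using second_moment_pos
  by (simp add: path_moment_def matrix_transpose_mul matrix_mul_assoc pos_def_def)

text \<open>Mass in one mode spreads to its successors with the transition weights. Symmetry of G
  makes the symmetrization inside \<open>jump\<close> act as the identity.\<close>

lemma T_axis:
  assumes "transpose G = G"
  shows "T K (axis i G) = (\<Sum>j\<in>UNIV. P $ i $ j *\<^sub>R axis j (closed_loop K $ i ** G ** transpose (closed_loop K $ i)))"
proof (subst vec_eq_iff, intro allI)
  fix j
  have "T K (axis i G) $ j
      = (\<Sum>m\<in>UNIV. if m = i then P $ i $ j *\<^sub>R (closed_loop K $ i ** G ** transpose (closed_loop K $ i)) else 0)"
    unfolding T_def jump_nth
    by (rule sum.cong) (auto simp: axis_def sym_part_id[OF assms] sym_part_scaleR[of 0, simplified]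
        mm.zero_left mm.zero_right)
  also have "\<dots> = (\<Sum>j'\<in>UNIV. P $ i $ j' *\<^sub>R axis j' (closed_loop K $ i ** G ** transpose (closed_loop K $ i))) $ j"
    by (simp add: axis_def if_distrib[of "\<lambda>x. _ *\<^sub>R x"] cong: if_cong)
  finally show "T K (axis i G) $ j
    = (\<Sum>j'\<in>UNIV. P $ i $ j' *\<^sub>R axis j' (closed_loop K $ i ** G ** transpose (closed_loop K $ i))) $ j" .
qed

text \<open>Each path puts its moment matrix into the slot of its current mode. Appending a mode
  multiplies the probability by one transition and sandwiches the moment by one closed-loop matrix,
  which is the action in \<open>T_axis\<close>.\<close>

lemma moment_sum: "(\<Sum>l\<in>paths t. path_prob t l *\<^sub>R axis (hd l) (path_moment K l)) = (T K ^^ t) X0"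
proof (induction t)
  case 0
  have "paths 0 = (\<lambda>i. [i]) ` UNIV" by (auto simp: length_Suc_conv image_iff)
  then have "(\<Sum>l\<in>paths 0. path_prob 0 l *\<^sub>R axis (hd l) (path_moment K l))
      = (\<Sum>i\<in>UNIV. \<pi> $ i *\<^sub>R axis i (second_moment D))"
    by (simp add: sum.reindex inj_on_def path_prob_0 path_moment_def)
  also have "\<dots> = X0"
    by (subst vec_eq_iff) (simp add: X0_def axis_def if_distrib[of "\<lambda>x. _ *\<^sub>R x"] cong: if_cong)
  finally show ?case by simp
next
  case (Suc t)
  interpret T: bounded_linear "T K" by (rule bounded_linear_T)
  have "(T K ^^ Suc t) X0 = T K (\<Sum>l\<in>paths t. path_prob t l *\<^sub>R axis (hd l) (path_moment K l))"
    using Suc by simp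
  also have "\<dots> = (\<Sum>l\<in>paths t. path_prob t l *\<^sub>R T K (axis (hd l) (path_moment K l)))"
    by (simp add: T.sum T.scaleR)
  also have "\<dots> = (\<Sum>l\<in>paths t. \<Sum>j\<in>UNIV. path_prob (Suc t) (j # l) *\<^sub>R axis j (path_moment K (j # l)))"
  proof (rule sum.cong[OF refl])
    fix l assume l: "l \<in> paths t"
    then have ne: "l \<noteq> []" by auto
    have "path_moment K (j # l) = closed_loop K $ hd l ** path_moment K l ** transpose (closed_loop K $ hd l)" for j
      using ne by (simp add: path_moment_def matrix_transpose_mul matrix_mul_assoc)
    then show "path_prob t l *\<^sub>R T K (axis (hd l) (path_moment K l))
        = (\<Sum>j\<in>UNIV. path_prob (Suc t) (j # l) *\<^sub>R axis j (path_moment K (j # l)))"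
      using l by (simp add: T_axis[OF transpose_path_moment] path_prob_Suc scaleR_sum_right mult.commute)
  qed
  finally show ?case by (simp add: sum_paths_Suc)
qed

text \<open>On each of the finitely many path events the state is a fixed linear image of
  \<open>x0\<close>; splitting along these events reduces the claim to
  \<open>expectation_hist\<close>.\<close>

lemma expectation_state:
  "integrable M (\<lambda>a. quad (Y $ \<omega> t a) (state \<omega> x0 A B K t a))"
  "expectation (\<lambda>a. quad (Y $ \<omega> t a) (state \<omega> x0 A B K t a)) = Y \<bullet> (T K ^^ t) X0"
proof -
  let ?f = "\<lambda>l a. quad (Y $ hd l) (propagator K l *v x0 a) * indicator {a. hist t a = l} a"
  have eq: "quad (Y $ \<omega> t a) (state \<omega> x0 A B K t a) = (\<Sum>l\<in>paths t. ?f l a)" for a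
  proof -
    have "(\<Sum>l\<in>paths t. ?f l a) = (\<Sum>l\<in>{hist t a}. ?f l a)"
      by (rule sum.mono_neutral_right[OF finite_paths]) (auto simp: length_hist indicator_def)
    then show ?thesis by (simp add: state_eq hd_hist)
  qed
  show "integrable M (\<lambda>a. quad (Y $ \<omega> t a) (state \<omega> x0 A B K t a))"
    unfolding eq by (intro Bochner_Integration.integrable_sum expectation_hist(1)) simp
  have "expectation (\<lambda>a. quad (Y $ \<omega> t a) (state \<omega> x0 A B K t a))
      = (\<Sum>l\<in>paths t. expectation (?f l))"
    unfolding eq by (intro Bochner_Integration.integral_sum expectation_hist(1)) simp
  also have "\<dots> = (\<Sum>l\<in>paths t. Y \<bullet> (path_prob t l *\<^sub>R axis (hd l) (path_moment K l)))"
    by (rule sum.cong) (simp_all add: expectation_hist(2) path_moment_def inner_axis)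
  also have "\<dots> = Y \<bullet> (T K ^^ t) X0"
    unfolding moment_sum[symmetric] by (simp add: inner_sum_right)
  finally show "expectation (\<lambda>a. quad (Y $ \<omega> t a) (state \<omega> x0 A B K t a)) = Y \<bullet> (T K ^^ t) X0" .
qed

text \<open>The sign of the pairing is read off from probability: it is the expectation of values of
  nonnegative forms.\<close>

lemma moment_nonneg: "psd Y \<Longrightarrow> 0 \<le> Y \<bullet> (T K ^^ t) X0"
  unfolding expectation_state(2)[symmetric] by (simp add: psd_def)

lemma quad_W: "quad (W K $ i) x = x \<bullet> ((Q $ i) *v x) + control K i x \<bullet> ((R $ i) *v control K i x)"
proof -
  have "control K i x \<bullet> ((R $ i) *v control K i x) = (K $ i *v x) \<bullet> (R $ i *v (K $ i *v x))"
    by (simp add: control_def linear_neg[OF matrix_vector_mul_linear])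
  also have "\<dots> = quad (control_weight K K $ i) x"
    using dot_lmul_matrix[of x "transpose (K $ i)" "R $ i *v (K $ i *v x)"]
    by (simp add: quad_def control_weight_def matrix_vector_mul_assoc matrix_mul_assoc del: transpose_matrix_vector)
  finally show ?thesis unfolding W_def vector_add_component quad_add by (simp add: quad_def)
qed

lemma psd_W_Lambda: "psd (W K - Lambda_min Q *\<^sub>R id_tuple)"
  unfolding psd_def
proof (intro allI)
  fix i x
  have "0 \<le> control K i x \<bullet> ((R $ i) *v control K i x)"
    using R_pos[of i] by (cases "control K i x = 0") (auto simp: pos_def_def less_imp_le)
  then show "0 \<le> quad ((W K - Lambda_min Q *\<^sub>R id_tuple) $ i) x"
    using Lambda_min_pos_def(2)[of Q x i] Q_pos
    by (simp add: quad_diff quad_W quad_scaleR quad_mat_1)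
qed

lemma psd_W: "psd (W K)"
  using psd_add[OF psd_W_Lambda[of K] psd_scaleR[OF _ psd_id_tuple]] Lambda_min_pos_def(1)[of Q] Q_pos
  by (metis diff_add_cancel less_imp_le)

text \<open>Sum and integral are exchanged for nonnegative terms, so the identity also covers
  infinite cost.\<close>

lemma cost_eq: "cost M \<omega> x0 A B Q R K = (\<Sum>t. ennreal (W K \<bullet> (T K ^^ t) X0))"
proof -
  have "cost M \<omega> x0 A B Q R K
      = (\<integral>\<^sup>+a. (\<Sum>t. ennreal (quad (W K $ \<omega> t a) (state \<omega> x0 A B K t a))) \<partial>M)"
    by (simp add: cost_def Let_def quad_W)
  also have "\<dots> = (\<Sum>t. \<integral>\<^sup>+a. ennreal (quad (W K $ \<omega> t a) (state \<omega> x0 A B K t a)) \<partial>M)"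
    by (rule nn_integral_suminf) (intro measurable_compose[OF _ measurable_ennreal]
        borel_measurable_integrable expectation_state(1))
  also have "\<dots> = (\<Sum>t. ennreal (W K \<bullet> (T K ^^ t) X0))"
  proof (intro suminf_cong)
    fix t
    have "0 \<le> quad (W K $ \<omega> t a) (state \<omega> x0 A B K t a)" for a using psd_W by (simp add: psd_def)
    then show "(\<integral>\<^sup>+a. ennreal (quad (W K $ \<omega> t a) (state \<omega> x0 A B K t a)) \<partial>M)
        = ennreal (W K \<bullet> (T K ^^ t) X0)"
      unfolding expectation_state(2)[symmetric]
      by (intro nn_integral_eq_integral expectation_state(1)) auto
  qed
  finally show ?thesis .
qed

lemma transpose_X0: "transpose (X0 $ i) = X0 $ i"
  using second_moment_pos by (simp add: X0_def transpose_scalar pos_def_def)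

lemma mu_pos: "0 < mu D \<pi>"
proof -
  have "Min (range (($) \<pi>)) \<in> range (($) \<pi>)" by (rule Min_in) auto
  then have "0 < Min (range (($) \<pi>))" using \<pi>_pos by auto
  then show ?thesis
    using sigma_min_pos_def(1)[OF second_moment_pos] by (simp add: mu_def)
qed

text \<open>This is the meaning of \<mu>: every mode starts with at least that much second moment in
  every direction.\<close>

lemma psd_X0_mu: "psd (X0 - mu D \<pi> *\<^sub>R id_tuple)"
  unfolding psd_def
proof (intro allI)
  fix i and v :: "real^'d"
  let ?s = "sigma_min (second_moment D)"
  have "mu D \<pi> * (v \<bullet> v) \<le> \<pi> $ i * (?s * (v \<bullet> v))"
    unfolding mu_def using sigma_min_pos_def(1)[OF second_moment_pos]
    by (subst mult.assoc, intro mult_right_mono) auto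
  also have "\<dots> \<le> \<pi> $ i * quad (second_moment D) v"
    using sigma_min_pos_def(2)[OF second_moment_pos] \<pi>_pos[of i]
    by (intro mult_left_mono) (auto simp: quad_def)
  finally show "0 \<le> quad ((X0 - mu D \<pi> *\<^sub>R id_tuple) $ i) v"
    by (simp add: quad_diff quad_scaleR quad_mat_1 X0_def)
qed

end

subsection \<open>Stability margin\<close>

text \<open>Scaling a and b to unit vectors before polarizing turns the mean of two forms into a
  product of norms.\<close>

lemma psd_bilinear_bound:
  assumes sym: "transpose X = X" and q: "\<And>v. 0 \<le> quad X v" "\<And>v. quad X v \<le> c * (v \<bullet> v)"
  shows "\<bar>a \<bullet> (X *v b)\<bar> \<le> c * norm a * norm b"
proof (cases "a = 0 \<or> b = 0")
  case False
  let ?a = "a /\<^sub>R norm a" and ?b = "b /\<^sub>R norm b"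
  have "\<bar>?a \<bullet> (X *v ?b)\<bar> \<le> (quad X ?a + quad X ?b) / 2"
    using q(1) by (intro polarization_bound[OF sym]) simp
  also have "\<dots> \<le> c" using q(2)[of ?a] q(2)[of ?b] False by (simp add: dot_square_norm)
  also have "?a \<bullet> (X *v ?b) = (a \<bullet> (X *v b)) / (norm a * norm b)"
    by (simp add: matrix_vector_mult_scaleR divide_inverse)
  finally show ?thesis using False by (simp add: abs_mult field_simps)
qed auto

context mjls begin

lemma stable_mono: "stable K s \<Longrightarrow> s \<le> s' \<Longrightarrow> stable K s'"
  unfolding stable_def by (meson order_trans)

text \<open>The closed loop of K' is that of K minus the gain of K' - K; telescope the product, one
  closed-loop factor at a time.\<close>

lemma T_diff: "T K' X - T K X = - jump (input_gain (K' - K)) (closed_loop K') X - jump (closed_loop K) (input_gain (K' - K)) X"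
proof -
  have "input_gain K' = input_gain (K' - K) + input_gain K" by (simp add: vec_eq_iff input_gain_def mm.diff_right)
  then have "closed_loop K = input_gain (K' - K) + closed_loop K'" by (simp add: closed_loop_def)
  then show ?thesis by (simp add: T_def jump_add)
qed

end

section \<open>Finite cost, stability and perturbation of the certificate\<close>

context mjls_process begin

abbreviation cost_real :: "real^'d^'k^'s \<Rightarrow> real" where
  "cost_real K \<equiv> enn2real (cost M \<omega> x0 A B Q R K)"

definition chi :: "real^'d^'k^'s \<Rightarrow> real^'d^'d^'s" where
  "chi K = S K X0"

lemma Lambda_pos: "0 < Lambda_min Q"
  using Lambda_min_pos_def(1) Q_pos by blast

lemma stable_cost:
  assumes st: "stable K s"
  shows "cost M \<omega> x0 A B Q R K < \<infinity>" and "cost_real K = W K \<bullet> chi K"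
proof -
  have sm: "summable (\<lambda>t. W K \<bullet> (T K ^^ t) X0)"
    by (rule bounded_linear.summable[OF bounded_linear_inner_right summable_T_pow[OF st]])
  have eq: "cost M \<omega> x0 A B Q R K = ennreal (\<Sum>t. W K \<bullet> (T K ^^ t) X0)"
    unfolding cost_eq by (rule suminf_ennreal2[OF moment_nonneg[OF psd_W] sm])
  then show "cost M \<omega> x0 A B Q R K < \<infinity>" by simp
  have "W K \<bullet> chi K = (\<Sum>t. W K \<bullet> (T K ^^ t) X0)"
    unfolding chi_def S_def
    by (rule bounded_linear.suminf[OF bounded_linear_inner_right summable_T_pow[OF st]])
  moreover have "0 \<le> (\<Sum>t. W K \<bullet> (T K ^^ t) X0)"
    by (rule suminf_nonneg[OF sm moment_nonneg[OF psd_W]])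
  ultimately show "cost_real K = W K \<bullet> chi K" by (simp add: eq)
qed

text \<open>W dominates \<open>Lambda_min Q\<close> times the identity and \<open>X0\<close>
  dominates \<mu> times the identity, so each term of the cost series dominates a fixed multiple of
  the trace in \<open>stable\<close>. A single finite number thus controls the operator on all
  tuples.\<close>

lemma finite_cost_stable:
  assumes fin: "cost M \<omega> x0 A B Q R K < \<infinity>"
  shows "stable K (cost_real K / (Lambda_min Q * mu D \<pi>))"
  unfolding stable_def
proof
  fix n
  have nn: "0 \<le> W K \<bullet> (T K ^^ t) X0" for t by (rule moment_nonneg[OF psd_W])
  have ne: "(\<Sum>t. ennreal (W K \<bullet> (T K ^^ t) X0)) \<noteq> top" using fin by (simp add: cost_eq)
  have sm: "summable (\<lambda>t. W K \<bullet> (T K ^^ t) X0)" by (rule summable_suminf_not_top[OF nn ne])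
  have C: "cost_real K = (\<Sum>t. W K \<bullet> (T K ^^ t) X0)"
    unfolding cost_eq suminf_ennreal2[OF nn sm] by (simp add: suminf_nonneg[OF sm nn])
  have "Lambda_min Q * mu D \<pi> * (id_tuple \<bullet> (T K ^^ t) id_tuple) \<le> W K \<bullet> (T K ^^ t) X0" for t
  proof -
    have "0 \<le> id_tuple \<bullet> (T K ^^ t) (X0 - mu D \<pi> *\<^sub>R id_tuple)"
      by (intro trace_nonneg psd_T_pow psd_X0_mu)
    then have "mu D \<pi> * (id_tuple \<bullet> (T K ^^ t) id_tuple) \<le> id_tuple \<bullet> (T K ^^ t) X0"
      by (simp add: linear_diff[OF linear_T_pow] linear_scale[OF linear_T_pow] inner_diff_right)
    then have "Lambda_min Q * (mu D \<pi> * (id_tuple \<bullet> (T K ^^ t) id_tuple))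
        \<le> Lambda_min Q * (id_tuple \<bullet> (T K ^^ t) X0)"
      using Lambda_pos by (intro mult_left_mono) auto
    also have "\<dots> \<le> W K \<bullet> (T K ^^ t) X0"
      using moment_nonneg[OF psd_W_Lambda, of K t K] by (simp add: inner_diff_left)
    finally show ?thesis by (simp add: mult.assoc)
  qed
  then have "Lambda_min Q * mu D \<pi> * (\<Sum>t<n. id_tuple \<bullet> (T K ^^ t) id_tuple)
      \<le> (\<Sum>t<n. W K \<bullet> (T K ^^ t) X0)"
    unfolding sum_distrib_left by (intro sum_mono)
  also have "\<dots> \<le> cost_real K" unfolding C by (rule sum_le_suminf[OF sm]) (auto simp: nn)
  finally show "(\<Sum>t<n. id_tuple \<bullet> (T K ^^ t) id_tuple) \<le> cost_real K / (Lambda_min Q * mu D \<pi>)"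
    using Lambda_pos mu_pos by (simp add: pos_le_divide_eq mult.commute)
qed

context
  fixes K s assumes st: "stable K s"
begin

lemma chi_fixpoint: "chi K = X0 + T K (chi K)"
  unfolding chi_def by (rule S_fixpoint[OF st])

lemma inner_chi_nonneg: "psd Y \<Longrightarrow> 0 \<le> Y \<bullet> chi K"
  unfolding chi_def S_def bounded_linear.suminf[OF bounded_linear_inner_right summable_T_pow[OF st]]
  by (intro suminf_nonneg bounded_linear.summable[OF bounded_linear_inner_right summable_T_pow[OF st]]
      moment_nonneg)

text \<open>The form of \<open>chi K\<close> is a pairing with a rank-one positive tuple, so bounds
  on it follow from \<open>inner_chi_nonneg\<close>.\<close>

lemma quad_chi_eq: "quad (chi K $ i) v = axis i (outer v v) \<bullet> chi K"
  by (simp add: quad_outer inner_axis' inner_commute)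

lemma quad_chi_nonneg: "0 \<le> quad (chi K $ i) v"
  unfolding quad_chi_eq by (rule inner_chi_nonneg) (simp add: psd_def quad_axis_outer)

lemma quad_chi_le_trace: "quad (chi K $ i) v \<le> (id_tuple \<bullet> chi K) * (v \<bullet> v)"
proof -
  have "psd ((v \<bullet> v) *\<^sub>R id_tuple - axis i (outer v v))"
    unfolding psd_def vector_minus_component quad_diff quad_axis_outer
    using Cauchy_Schwarz_ineq[of v] by (auto simp: quad_scaleR quad_mat_1)
  then show ?thesis
    using inner_chi_nonneg by (fastforce simp: quad_chi_eq inner_diff_left mult.commute)
qed

lemma trace_chi_le: "id_tuple \<bullet> chi K \<le> cost_real K / Lambda_min Q"
  using inner_chi_nonneg[OF psd_W_Lambda, of K] Lambda_pos
  by (simp add: stable_cost(2)[OF st] inner_diff_left pos_le_divide_eq mult.commute)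

lemma quad_chi_le: "quad (chi K $ i) v \<le> cost_real K / Lambda_min Q * (v \<bullet> v)"
  by (rule order_trans[OF quad_chi_le_trace mult_right_mono[OF trace_chi_le inner_ge_zero]])

lemma transpose_chi: "transpose (chi K $ i) = chi K $ i"
  by (subst (1 2) chi_fixpoint) (simp add: transpose_add transpose_X0 transpose_T)

lemma psd_chi: "psd (chi K)"
  by (simp add: psd_def quad_chi_nonneg)

lemma quad_T_chi_le: "quad (T K (chi K) $ i) v \<le> quad (chi K $ i) v - mu D \<pi> * (v \<bullet> v)"
proof -
  have "mu D \<pi> * (v \<bullet> v) \<le> quad (X0 $ i) v"
    using psd_X0_mu by (simp add: psd_def quad_diff quad_scaleR quad_mat_1)
  moreover have "quad (chi K $ i) v = quad (X0 $ i) v + quad (T K (chi K) $ i) v"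
    by (subst chi_fixpoint) (simp add: quad_add)
  ultimately show ?thesis by simp
qed

text \<open>\<open>chi K\<close> dominates \<open>X0\<close>, so its trace is at least \<mu>. In
  \<open>stable_perturbation\<close> this makes the admissible \<delta> small independently of the
  cost.\<close>

lemma mu_le_cost: "Lambda_min Q * mu D \<pi> \<le> cost_real K"
proof -
  have "psd (chi K - mu D \<pi> *\<^sub>R id_tuple)"
    using psd_add[OF psd_X0_mu psd_T[OF psd_chi, of K]] chi_fixpoint
    by (metis add_diff_eq add.commute)
  then have "mu D \<pi> * (id_tuple \<bullet> (id_tuple :: real^'d^'d^'s)) \<le> id_tuple \<bullet> chi K"
    using trace_nonneg by (fastforce simp: inner_diff_right)
  moreover have "mu D \<pi> * 1 \<le> mu D \<pi> * (id_tuple \<bullet> (id_tuple :: real^'d^'d^'s))"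
    using mu_pos by (intro mult_left_mono id_tuple_inner_self) auto
  ultimately have "mu D \<pi> \<le> cost_real K / Lambda_min Q" using trace_chi_le by simp
  then show ?thesis using Lambda_pos by (simp add: pos_le_divide_eq mult.commute)
qed

text \<open>The certificate \<open>2/\<mu> * chi K\<close> of \<open>K\<close> decreases strictly enough to survive a small change
  of the policy.\<close>

lemma stable_perturbation:
  assumes close: "4 * cost_real K * (\<Sum>i\<in>UNIV. sigma_max (B $ i) * (sigma_max (A $ i - B $ i ** K $ i) + 1))
      * tuple_norm (K' - K) \<le> Lambda_min Q * mu D \<pi>"
  shows "stable K' (2 * (cost_real K / Lambda_min Q) / mu D \<pi>)"
proof -
  define x where "x = cost_real K / Lambda_min Q"
  define \<delta> where "\<delta> = tuple_norm (K' - K)"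
  define b where "b i = sigma_max (B $ i)" for i
  define l where "l i = sigma_max (A $ i - B $ i ** K $ i)" for i
  define \<sigma> where "\<sigma> = (\<Sum>i\<in>UNIV. b i * (l i + 1))"
  have nn: "0 \<le> b i" "0 \<le> l i" "0 \<le> \<delta>" for i
    by (simp_all add: b_def l_def \<delta>_def sigma_max_nonneg tuple_norm_nonneg)
  have x0: "0 \<le> x" using Lambda_pos by (simp add: x_def)
  have mx: "mu D \<pi> \<le> x" using mu_le_cost Lambda_pos by (simp add: x_def pos_le_divide_eq mult.commute)
  have "4 * (cost_real K / Lambda_min Q) * \<sigma> * \<delta> \<le> mu D \<pi>"
    using close Lambda_pos by (simp add: \<sigma>_def \<delta>_def b_def l_def divide_simps mult_ac)
  then have xs: "4 * x * \<sigma> * \<delta> \<le> mu D \<pi>" by (simp add: x_def)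
  then have "x * (4 * \<sigma> * \<delta>) \<le> x * 1" using mx by (simp add: mult_ac)
  \<comment> \<open>Here \<mu> \<le> x cancels the cost from the radius condition; the term
    quadratic in \<delta> can then be absorbed into a linear one.\<close>
  then have sd: "4 * \<sigma> * \<delta> \<le> 1" using mx mu_pos by (subst (asm) mult_le_cancel_left_pos) auto
  have bl: "b i * (l i + 1) \<le> \<sigma>" for i
    unfolding \<sigma>_def by (rule member_le_sum) (auto simp: nn)
  have "b i \<le> b i * (l i + 1)" for i using nn by (simp add: algebra_simps)
  then have "b i \<le> \<sigma>" for i using bl order_trans by blast
  then have b\<delta>: "b i * \<delta> \<le> \<sigma> * \<delta>" for i using nn by (simp add: mult_right_mono)
  have bd: "b i * \<delta> \<le> 1" for i using sd b\<delta>[of i] by linarith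
  \<comment> \<open>Expand the form at a - c. The cross term contributes 2 x l b \<delta>; the
    square of c contributes at most x b \<delta>, doubled so that the sum factors as 2 x \<delta> b
    (l + 1). This is the origin of the summands in the radius.\<close>
  have step: "quad (chi K $ i) (v v* closed_loop K' $ i)
      \<le> quad (chi K $ i) (v v* closed_loop K $ i) + 2 * x * \<delta> * (b i * (l i + 1)) * (v \<bullet> v)" for i v
  proof -
    define a where "a = v v* closed_loop K $ i"
    define c where "c = v v* (B $ i ** (K' - K) $ i)"
    have "closed_loop K' $ i = closed_loop K $ i - B $ i ** (K' - K) $ i"
      by (simp add: closed_loop_def input_gain_def mm.diff_right)
    then have ac: "v v* closed_loop K' $ i = a - c"
      by (simp add: a_def c_def vector_matrix_mult_diff_rdistrib)
    have na: "norm a \<le> l i * norm v"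
      using norm_vector_matrix_le[of v "closed_loop K $ i"] by (simp add: a_def l_def closed_loop_def input_gain_def)
    have nc: "norm c \<le> b i * \<delta> * norm v"
    proof -
      have "norm c \<le> sigma_max ((K' - K) $ i) * norm (v v* B $ i)"
        using norm_vector_matrix_le[of "v v* B $ i" "(K' - K) $ i"]
        by (simp add: c_def vector_matrix_mul_assoc)
      also have "\<dots> \<le> \<delta> * (b i * norm v)"
        unfolding \<delta>_def b_def
        by (intro mult_mono tuple_norm_ge norm_vector_matrix_le tuple_norm_nonneg norm_ge_zero)
      finally show ?thesis by (simp add: mult_ac)
    qed
    have s: "c \<bullet> (chi K $ i *v a) = a \<bullet> (chi K $ i *v c)"
      by (metis transpose_chi dot_lmul_matrix inner_commute transpose_matrix_vector)
    have "quad (chi K $ i) (a - c) = quad (chi K $ i) a - 2 * (a \<bullet> (chi K $ i *v c)) + quad (chi K $ i) c"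
      using s by (simp add: quad_def matrix_vector_mult_diff_distrib inner_diff_left inner_diff_right)
    moreover have "- 2 * (a \<bullet> (chi K $ i *v c)) \<le> 2 * (x * norm a * norm c)"
      using psd_bilinear_bound[OF transpose_chi[of i] quad_chi_nonneg quad_chi_le, of a c]
      by (simp add: x_def)
    moreover have "x * norm a * norm c \<le> x * (l i * norm v) * (b i * \<delta> * norm v)"
      using na nc x0 nn by (intro mult_mono) auto
    moreover have "quad (chi K $ i) c \<le> x * (c \<bullet> c)" unfolding x_def by (rule quad_chi_le)
    moreover have "x * (c \<bullet> c) \<le> x * (2 * b i * \<delta> * (v \<bullet> v))"
    proof -
      have "norm c \<le> 1 * norm v"
        by (rule order_trans[OF nc mult_right_mono[OF bd norm_ge_zero]])
      have "c \<bullet> c = norm c * norm c" by (simp add: dot_square_norm power2_eq_square)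
      also have "\<dots> \<le> (b i * \<delta> * norm v) * (1 * norm v)"
        using nc \<open>norm c \<le> 1 * norm v\<close> nn by (intro mult_mono) auto
      also have "\<dots> = b i * \<delta> * (v \<bullet> v)" by (simp add: dot_square_norm power2_eq_square)
      also have "\<dots> \<le> 2 * b i * \<delta> * (v \<bullet> v)" using nn by simp
      finally show ?thesis using x0 by (simp add: mult_left_mono)
    qed
    moreover have "2 * x * \<delta> * (b i * (l i + 1)) * (v \<bullet> v)
        = 2 * (x * (l i * norm v) * (b i * \<delta> * norm v)) + x * (2 * b i * \<delta> * (v \<bullet> v))"
      unfolding dot_square_norm power2_eq_square by (simp add: algebra_simps)
    ultimately show ?thesis
      unfolding ac a_def[symmetric] by linarith
  qed
  \<comment> \<open>The perturbation consumes at most half of the decrease \<mu> that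
    \<open>chi K\<close> has along \<open>T K\<close>.\<close>
  have key: "quad (T K' (chi K) $ j) v \<le> quad (chi K $ j) v - mu D \<pi> / 2 * (v \<bullet> v)" for j v
  proof -
    have "P $ i $ j * quad (chi K $ i) (v v* closed_loop K' $ i)
        \<le> P $ i $ j * quad (chi K $ i) (v v* closed_loop K $ i) + 2 * x * \<delta> * (b i * (l i + 1)) * (v \<bullet> v)" for i
    proof -
      have p1: "P $ i $ j \<le> 1"
        using member_le_sum[of j UNIV "\<lambda>j. P $ i $ j"] P_nonneg P_sum[of i] by auto
      have "0 \<le> 2 * x * \<delta> * (b i * (l i + 1)) * (v \<bullet> v)" using nn x0 by simp
      from mult_right_mono[OF p1 this]
      have "P $ i $ j * (2 * x * \<delta> * (b i * (l i + 1)) * (v \<bullet> v))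
          \<le> 2 * x * \<delta> * (b i * (l i + 1)) * (v \<bullet> v)"
        by (simp only: mult_1)
      then show ?thesis
        using mult_left_mono[OF step[of i v] P_nonneg[of i j]] by (simp add: distrib_left)
    qed
    then have "quad (T K' (chi K) $ j) v
        \<le> (\<Sum>i\<in>UNIV. P $ i $ j * quad (chi K $ i) (v v* closed_loop K $ i)
            + 2 * x * \<delta> * (b i * (l i + 1)) * (v \<bullet> v))"
      unfolding quad_T by (intro sum_mono)
    also have "\<dots> = quad (T K (chi K) $ j) v + 2 * x * \<delta> * \<sigma> * (v \<bullet> v)"
      by (simp add: quad_T sum.distrib \<sigma>_def sum_distrib_left sum_distrib_right)
    also have "2 * x * \<delta> * \<sigma> * (v \<bullet> v) \<le> mu D \<pi> / 2 * (v \<bullet> v)"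
      using xs by (intro mult_right_mono) (auto simp: mult_ac)
    also have "quad (T K (chi K) $ j) v + mu D \<pi> / 2 * (v \<bullet> v)
        \<le> quad (chi K $ j) v - mu D \<pi> / 2 * (v \<bullet> v)"
      using quad_T_chi_le[of j v] by (simp add: field_simps)
    finally show ?thesis by simp
  qed
  \<comment> \<open>The factor 2/\<mu> turns the remaining decrease \<mu>/2 into the identity
    demanded of a certificate.\<close>
  define Y where "Y = (2 / mu D \<pi>) *\<^sub>R chi K"
  have "stable K' (id_tuple \<bullet> Y)"
  proof (rule stable_of_certificate)
    show "psd Y" unfolding Y_def using mu_pos by (intro psd_scaleR psd_chi) auto
    show "psd (Y - T K' Y - id_tuple)"
      unfolding psd_def
    proof (intro allI)
      fix j and v :: "real^'d"
      have "quad ((Y - T K' Y - id_tuple) $ j) v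
          = (2 / mu D \<pi>) * (quad (chi K $ j) v - quad (T K' (chi K) $ j) v) - v \<bullet> v"
        by (simp add: Y_def linear_scale[OF bounded_linear.linear[OF bounded_linear_T]] quad_diff quad_scaleR
            quad_mat_1 right_diff_distrib)
      moreover have "(2 / mu D \<pi>) * (mu D \<pi> / 2 * (v \<bullet> v))
          \<le> (2 / mu D \<pi>) * (quad (chi K $ j) v - quad (T K' (chi K) $ j) v)"
        using key[of j v] mu_pos by (intro mult_left_mono) auto
      ultimately show "0 \<le> quad ((Y - T K' Y - id_tuple) $ j) v" using mu_pos by simp
    qed
  qed
  moreover have "id_tuple \<bullet> Y \<le> 2 * x / mu D \<pi>"
  proof -
    have "(2 / mu D \<pi>) * (id_tuple \<bullet> chi K) \<le> (2 / mu D \<pi>) * x"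
      using trace_chi_le mu_pos unfolding x_def by (intro mult_left_mono) auto
    then show ?thesis by (simp add: Y_def)
  qed
  ultimately show ?thesis unfolding x_def using stable_mono by blast
qed

text \<open>Stability is open, with one bound for the whole neighbourhood; the differentiability
  proof works inside it. L = K is included, so K obeys the same bound as its neighbours.\<close>

lemma stable_nbhd:
  obtains \<epsilon> where "0 < \<epsilon>" and
    "\<And>L. norm (L - K) < \<epsilon> \<Longrightarrow> stable L (2 * (cost_real K / Lambda_min Q) / mu D \<pi>)"
proof -
  define g where "g = 4 * cost_real K *
    (\<Sum>i\<in>UNIV. sigma_max (B $ i) * (sigma_max (A $ i - B $ i ** K $ i) + 1))"
  have g: "0 \<le> g" by (auto simp: g_def intro!: mult_nonneg_nonneg sum_nonneg add_nonneg_nonneg sigma_max_nonneg)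
  have lm: "0 < Lambda_min Q * mu D \<pi>" using Lambda_pos mu_pos by simp
  \<comment> \<open>The 1 in the denominator guards against g = 0, which happens when all B
    vanish.\<close>
  let ?e = "Lambda_min Q * mu D \<pi> / (g + 1)"
  have "stable L (2 * (cost_real K / Lambda_min Q) / mu D \<pi>)" if "norm (L - K) < ?e" for L
  proof (rule stable_perturbation)
    have "g * tuple_norm (L - K) \<le> (g + 1) * norm (L - K)"
      using g tuple_norm_le_norm[of "L - K"] tuple_norm_nonneg[of "L - K"] by (intro mult_mono) auto
    also have "\<dots> \<le> (g + 1) * ?e" using that g by (intro mult_left_mono) auto
    also have "\<dots> = Lambda_min Q * mu D \<pi>" using g by simp
    finally show "4 * cost_real K * (\<Sum>i\<in>UNIV. sigma_max (B $ i) * (sigma_max (A $ i - B $ i ** K $ i) + 1))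
      * tuple_norm (L - K) \<le> Lambda_min Q * mu D \<pi>" by (simp add: g_def)
  qed
  moreover have "0 < ?e" using lm g by simp
  ultimately show ?thesis using that by blast
qed

end

end

subsection \<open>Perturbation bounds\<close>

lemma norm_tuple_le_sum: "norm (V::real^'q^'p^'s) \<le> (\<Sum>i\<in>UNIV. norm (V $ i))"
  by (simp add: norm_vec_def L2_set_le_sum)

lemma inner_bound:
  fixes x y :: "'x::real_inner"
  assumes "norm x \<le> u" "norm y \<le> v"
  shows "\<bar>x \<bullet> y\<bar> \<le> u * v"
  using Cauchy_Schwarz_ineq2[of x y] mult_mono[OF assms order_trans[OF norm_ge_zero assms(1)] norm_ge_zero]
  by linarith

text \<open>Pair the adjoint value with itself and cancel one factor.\<close>

lemma norm_adjoint_le: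
  fixes f :: "'x::euclidean_space \<Rightarrow> 'y::euclidean_space"
  assumes f: "linear f" and le: "\<And>x. norm (f x) \<le> c * norm x"
  shows "norm (adjoint f y) \<le> c * norm y"
proof (cases "adjoint f y = 0")
  case True
  have "0 \<le> c" using le order_trans[OF norm_ge_zero]
    by (metis SOME_Basis mult_cancel_left1 norm_Basis order_trans norm_ge_zero mult.right_neutral)
  with True show ?thesis by simp
next
  case False
  have "norm (adjoint f y) * norm (adjoint f y) = f (adjoint f y) \<bullet> y"
    by (simp add: adjoint_works[OF f, symmetric] dot_square_norm power2_eq_square)
  also have "\<dots> \<le> norm (f (adjoint f y)) * norm y" by (rule norm_cauchy_schwarz)
  also have "\<dots> \<le> c * norm (adjoint f y) * norm y" by (intro mult_right_mono le) simp
  finally show ?thesis using False by simp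
qed

section \<open>Value matrices and directional derivatives\<close>

context mjls begin

text \<open>For stable K this solves the dual Lyapunov equation V = W + T'V, with T' the adjoint of
  \<open>T K\<close>. Transposing the resolvent carries its norm bound over.\<close>

definition value_matrices :: "real^'d^'k^'s \<Rightarrow> real^'d^'d^'s" where
  "value_matrices K = adjoint (S K) (W K)"

definition dT :: "real^'d^'k^'s \<Rightarrow> real^'d^'k^'s \<Rightarrow> real^'d^'d^'s \<Rightarrow> real^'d^'d^'s" where
  "dT K H X = - jump (input_gain H) (closed_loop K) X - jump (closed_loop K) (input_gain H) X"

definition dW :: "real^'d^'k^'s \<Rightarrow> real^'d^'k^'s \<Rightarrow> real^'d^'d^'s" where
  "dW K H = control_weight K H + control_weight H K"

lemma input_gain_add: "input_gain (G + H) = input_gain G + input_gain H"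
  by (simp add: vec_eq_iff input_gain_def mm.add_right)

lemma input_gain_scaleR: "input_gain (r *\<^sub>R H) = r *\<^sub>R input_gain H"
  by (subst vec_eq_iff) (simp add: input_gain_def mm.scaleR_right)

lemma norm_input_gain_le: "norm (input_gain H) \<le> real CARD('s) * norm B * norm H"
proof -
  have "norm (input_gain H) \<le> (\<Sum>i\<in>UNIV. norm (input_gain H $ i))" by (rule norm_tuple_le_sum)
  also have "\<dots> \<le> (\<Sum>i\<in>(UNIV::'s set). norm B * norm H)"
  proof (rule sum_mono)
    show "norm (input_gain H $ i) \<le> norm B * norm H" for i
      using order_trans[OF norm_matrix_mult_le[of "B $ i" "H $ i"]
          mult_mono[OF Finite_Cartesian_Product.norm_nth_le[of B i] Finite_Cartesian_Product.norm_nth_le[of H i]]]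
      by (simp add: input_gain_def)
  qed
  finally show ?thesis by (simp add: mult.assoc)
qed

lemma norm_closed_loop_le: "norm (closed_loop K) \<le> norm A + real CARD('s) * norm B * norm K"
  unfolding closed_loop_def by (rule order_trans[OF norm_triangle_ineq4 add_left_mono[OF norm_input_gain_le]])

lemma control_weight_add: "control_weight (U + U') V = control_weight U V + control_weight U' V" "control_weight U (V + V') = control_weight U V + control_weight U V'"
  by (subst vec_eq_iff, simp add: control_weight_def mm.add_left mm.add_right transpose_add)+

lemma control_weight_scaleR: "control_weight (r *\<^sub>R U) V = r *\<^sub>R control_weight U V" "control_weight U (r *\<^sub>R V) = r *\<^sub>R control_weight U V"
  by (subst vec_eq_iff, simp add: control_weight_def mm.scaleR_left mm.scaleR_right transpose_scalar)+

lemma norm_control_weight_le: "norm (control_weight U V) \<le> real CARD('s) * norm R * norm U * norm V"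
proof -
  have "norm (control_weight U V) \<le> (\<Sum>i\<in>UNIV. norm (control_weight U V $ i))" by (rule norm_tuple_le_sum)
  also have "\<dots> \<le> (\<Sum>i\<in>(UNIV::'s set). norm U * norm R * norm V)"
  proof (rule sum_mono)
    fix i
    have "norm (control_weight U V $ i) \<le> norm (transpose (U $ i) ** R $ i) * norm (V $ i)"
      unfolding control_weight_def by (simp add: norm_matrix_mult_le)
    also have "\<dots> \<le> norm (transpose (U $ i)) * norm (R $ i) * norm (V $ i)"
      by (intro mult_right_mono norm_matrix_mult_le norm_ge_zero)
    also have "\<dots> \<le> norm U * norm R * norm V"
      unfolding norm_transpose
      by (intro mult_mono Finite_Cartesian_Product.norm_nth_le mult_nonneg_nonneg norm_ge_zero)
    finally show "norm (control_weight U V $ i) \<le> norm U * norm R * norm V" .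
  qed
  finally show ?thesis by (simp add: mult_ac)
qed

lemma inner_value_matrices:
  assumes "stable K s"
  shows "value_matrices K \<bullet> Z = W K \<bullet> S K Z"
  using adjoint_works[OF linear_S[OF assms], of Z "W K"] by (simp add: value_matrices_def inner_commute)

text \<open>The dual Lyapunov equation, tested against an arbitrary Z.\<close>

lemma inner_value_matrices_residual: "stable K s \<Longrightarrow> value_matrices K \<bullet> (Z - T K Z) = W K \<bullet> Z"
  by (simp add: inner_value_matrices S_residual)

lemma norm_value_matrices_le: "stable K s \<Longrightarrow> norm (value_matrices K) \<le> real CARD('d) * s * norm (W K)"
  unfolding value_matrices_def by (rule norm_adjoint_le[OF linear_S norm_S_le])

lemma W_diff: "W K' - W K = control_weight (K' - K) K' + control_weight K (K' - K)"
  using control_weight_add(1)[of K "K' - K" K'] control_weight_add(2)[of K K "K' - K"] by (simp add: W_def)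

text \<open>W is quadratic in the policy, so what remains after the linear part is the quadratic
  part itself.\<close>

lemma W_remainder: "W K' - W K - dW K (K' - K) = control_weight (K' - K) (K' - K)"
  using control_weight_add(2)[of "K' - K" K "K' - K"] by (simp add: W_diff dW_def)

lemma dW_diff: "dW K' H - dW K H = control_weight (K' - K) H + control_weight H (K' - K)"
  using control_weight_add(1)[of K "K' - K" H] control_weight_add(2)[of H K "K' - K"] by (simp add: dW_def)

lemma closed_loop_split: "closed_loop K = input_gain (K' - K) + closed_loop K'"
  using input_gain_add[of "K' - K" K] by (simp add: closed_loop_def)

text \<open>\<open>T_diff\<close> and \<open>dT\<close> differ in one slot only, the closed loop of
  K' against that of K, which leaves the increment in both slots.\<close>

lemma T_remainder:
  "T K' X - T K X - dT K (K' - K) X = jump (input_gain (K' - K)) (input_gain (K' - K)) X"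
  using jump_add(2)[of "input_gain (K' - K)" "input_gain (K' - K)" "closed_loop K'" X]
  by (simp add: T_diff dT_def flip: closed_loop_split)

lemma dT_diff:
  "dT K' H X - dT K H X = jump (input_gain H) (input_gain (K' - K)) X + jump (input_gain (K' - K)) (input_gain H) X"
  using jump_add(2)[of "input_gain H" "input_gain (K' - K)" "closed_loop K'" X]
    jump_add(1)[of "input_gain (K' - K)" "closed_loop K'" "input_gain H" X]
  by (simp add: dT_def flip: closed_loop_split)

end

section \<open>The derivative of the cost and its Lipschitz estimates\<close>

context mjls_process begin

text \<open>The direct effect of H on the stage cost, plus its effect on the dynamics priced by the
  value matrices.\<close>

definition dcost :: "real^'d^'k^'s \<Rightarrow> real^'d^'k^'s \<Rightarrow> real" where
  "dcost K H = dW K H \<bullet> chi K + value_matrices K \<bullet> dT K H (chi K)"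

lemma linear_dcost: "linear (dcost K)"
  by (rule linearI) (simp_all add: dcost_def dW_def dT_def input_gain_add input_gain_scaleR control_weight_add control_weight_scaleR
      jump_add jump_scaleR inner_add_left inner_add_right inner_diff_right inner_left_distrib
      inner_right_distrib algebra_simps)

definition grad :: "real^'d^'k^'s \<Rightarrow> real^'d^'k^'s" where
  "grad K = adjoint (dcost K) 1"

lemma inner_grad: "H \<bullet> grad K = dcost K H"
  using adjoint_works[OF linear_dcost, of H K 1] by (simp add: grad_def)

text \<open>One number b \<ge> 1 majorizes all data for K and K' alike, so every estimate is a power
  of b and lower powers can be raised to the highest.\<close>

context
  fixes K K' :: "real^'d^'k^'s" and s b :: real
  assumes st: "stable K s" and st': "stable K' s"
    and b1: "1 \<le> b" and bs: "real CARD('d) * s \<le> b"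
    and bK: "norm K \<le> b" "norm K' \<le> b" "norm (closed_loop K) \<le> b" "norm (closed_loop K') \<le> b"
    and bX: "norm X0 \<le> b" and bQ: "norm Q \<le> b" and bR: "real CARD('s) * norm R \<le> b"
    and bS: "real CARD('s) \<le> b" and bB: "real CARD('s) * norm B \<le> b"
begin

lemma jump_bound:
  assumes "norm U \<le> u" "norm V \<le> v" "norm X \<le> x"
  shows "norm (jump U V X) \<le> b * u * v * x"
  by (rule order_trans[OF norm_jump_le])
    (intro mult_mono assms bS; use assms b1 in \<open>auto intro!: mult_nonneg_nonneg intro: order_trans[OF norm_ge_zero]\<close>)

lemma control_weight_bound:
  assumes "norm U \<le> u" "norm V \<le> v"
  shows "norm (control_weight U V) \<le> b * u * v"
  by (rule order_trans[OF norm_control_weight_le])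
    (intro mult_mono assms bR; use assms b1 in \<open>auto intro!: mult_nonneg_nonneg intro: order_trans[OF norm_ge_zero]\<close>)

lemma input_gain_bound: "norm (input_gain H) \<le> b * norm H"
  by (rule order_trans[OF norm_input_gain_le mult_right_mono[OF bB]]) simp

lemma S_bound: "norm (S K Z) \<le> b * norm Z" "norm (S K' Z) \<le> b * norm Z"
  by (rule order_trans[OF norm_S_le[OF st] mult_right_mono[OF bs]], simp)
    (rule order_trans[OF norm_S_le[OF st'] mult_right_mono[OF bs]], simp)

lemma chi_bound: "norm (chi K) \<le> b^2" "norm (chi K') \<le> b^2"
proof -
  have "b * norm X0 \<le> b^2" unfolding power2_eq_square using b1 bX by (intro mult_left_mono) auto
  then show "norm (chi K) \<le> b^2" "norm (chi K') \<le> b^2"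
    unfolding chi_def using S_bound order_trans by blast+
qed

lemma W_bound: "norm (W K) \<le> 2 * b^3"
proof -
  have "norm (W K) \<le> norm Q + norm (control_weight K K)" unfolding W_def by (rule norm_triangle_ineq)
  also have "\<dots> \<le> b + b * b * b" by (rule add_mono[OF bQ control_weight_bound[OF bK(1) bK(1)]])
  also have "\<dots> \<le> 2 * b^3"
    using power_increasing[of 1 3 b] b1 by (simp add: power3_eq_cube)
  finally show ?thesis .
qed

lemma value_matrices_bound: "norm (value_matrices K) \<le> 2 * b^4"
proof -
  have "norm (value_matrices K) \<le> b * norm (W K)"
    by (rule order_trans[OF norm_value_matrices_le[OF st] mult_right_mono[OF bs]]) simp
  also have "\<dots> \<le> b * (2 * b^3)" using b1 W_bound by (intro mult_left_mono) auto
  finally show ?thesis by (simp add: power_numeral_reduce mult_ac)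
qed

abbreviation (input) \<delta> :: real where "\<delta> \<equiv> norm (K' - K)"

lemma T_diff_bound: "norm (T K' X - T K X) \<le> 2 * b^3 * \<delta> * norm X"
proof -
  have "norm (T K' X - T K X) \<le> norm (jump (input_gain (K' - K)) (closed_loop K') X) + norm (jump (closed_loop K) (input_gain (K' - K)) X)"
    unfolding T_diff using norm_triangle_ineq4[of "- jump (input_gain (K' - K)) (closed_loop K') X"] by simp
  also have "\<dots> \<le> b * (b * \<delta>) * b * norm X + b * b * (b * \<delta>) * norm X"
    by (intro add_mono jump_bound input_gain_bound bK order_refl)
  finally show ?thesis by (simp add: power3_eq_cube mult_ac)
qed

lemma dT_bound: "norm (dT K H X) \<le> 2 * b^3 * norm H * norm X" "norm (dT K' H X) \<le> 2 * b^3 * norm H * norm X"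
proof -
  have "norm (dT L H X) \<le> 2 * b^3 * norm H * norm X" if "norm (closed_loop L) \<le> b" for L
  proof -
    have "norm (dT L H X) \<le> norm (jump (input_gain H) (closed_loop L) X) + norm (jump (closed_loop L) (input_gain H) X)"
      unfolding dT_def using norm_triangle_ineq4[of "- jump (input_gain H) (closed_loop L) X"] by simp
    also have "\<dots> \<le> b * (b * norm H) * b * norm X + b * b * (b * norm H) * norm X"
      by (intro add_mono jump_bound input_gain_bound that order_refl)
    finally show ?thesis by (simp add: power3_eq_cube mult_ac)
  qed
  then show "norm (dT K H X) \<le> 2 * b^3 * norm H * norm X" "norm (dT K' H X) \<le> 2 * b^3 * norm H * norm X"
    using bK by blast+
qed

lemma dT_diff_bound: "norm (dT K' H X - dT K H X) \<le> 2 * b^3 * norm H * \<delta> * norm X"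
proof -
  have "norm (dT K' H X - dT K H X) \<le> b * (b * norm H) * (b * \<delta>) * norm X + b * (b * \<delta>) * (b * norm H) * norm X"
    unfolding dT_diff
    by (rule order_trans[OF norm_triangle_ineq]) (intro add_mono jump_bound input_gain_bound order_refl)
  then show ?thesis by (simp add: power3_eq_cube mult_ac)
qed

lemma T_remainder_bound: "norm (T K' X - T K X - dT K (K' - K) X) \<le> b^3 * \<delta>^2 * norm X"
  unfolding T_remainder using jump_bound[OF input_gain_bound input_gain_bound order_refl, of "K' - K" "K' - K" X]
  by (simp add: power3_eq_cube power2_eq_square mult_ac)

lemma W_diff_bound: "norm (W K' - W K) \<le> 2 * b^2 * \<delta>"
proof -
  have "norm (W K' - W K) \<le> b * \<delta> * b + b * b * \<delta>"
    unfolding W_diff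
    by (rule order_trans[OF norm_triangle_ineq]) (intro add_mono control_weight_bound bK order_refl)
  then show ?thesis by (simp add: power2_eq_square mult_ac)
qed

lemma dW_bound: "norm (dW K H) \<le> 2 * b^2 * norm H"
proof -
  have "norm (dW K H) \<le> b * b * norm H + b * norm H * b"
    unfolding dW_def
    by (rule order_trans[OF norm_triangle_ineq]) (intro add_mono control_weight_bound bK order_refl)
  then show ?thesis by (simp add: power2_eq_square mult_ac)
qed

lemma dW_diff_bound: "norm (dW K' H - dW K H) \<le> 2 * b * norm H * \<delta>"
proof -
  have "norm (dW K' H - dW K H) \<le> b * \<delta> * norm H + b * norm H * \<delta>"
    unfolding dW_diff
    by (rule order_trans[OF norm_triangle_ineq]) (intro add_mono control_weight_bound order_refl)
  then show ?thesis by (simp add: mult_ac)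
qed

lemma W_remainder_bound: "norm (W K' - W K - dW K (K' - K)) \<le> b * \<delta>^2"
  unfolding W_remainder using control_weight_bound[OF order_refl order_refl, of "K' - K" "K' - K"]
  by (simp add: power2_eq_square mult_ac)

text \<open>Resolvent identity: 1 - \<open>T K'\<close> sends the increment of \<open>chi\<close> to
  the increment of T applied to \<open>chi K\<close>, and \<open>S K'\<close> undoes the
  former.\<close>

lemma chi_diff_bound: "norm (chi K' - chi K) \<le> 2 * b^6 * \<delta>"
proof -
  let ?Z = "chi K' - chi K"
  have "T K (chi K) = chi K - X0" "T K' (chi K') = chi K' - X0"
    using chi_fixpoint[OF st] chi_fixpoint[OF st'] by (metis add_diff_cancel_left')+
  then have "?Z - T K' ?Z = T K' (chi K) - T K (chi K)"
    by (simp add: linear_diff[OF bounded_linear.linear[OF bounded_linear_T]])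
  then have "norm ?Z \<le> b * norm (T K' (chi K) - T K (chi K))"
    using S_bound(2)[of "?Z - T K' ?Z"] S_residual[OF st', of ?Z] by simp
  also have "\<dots> \<le> b * (2 * b^3 * \<delta> * b^2)"
  proof (rule mult_left_mono)
    show "norm (T K' (chi K) - T K (chi K)) \<le> 2 * b^3 * \<delta> * b^2"
      by (rule order_trans[OF T_diff_bound mult_left_mono[OF chi_bound(1)]]) (use b1 in auto)
  qed (use b1 in auto)
  finally show ?thesis by (simp add: power_numeral_reduce mult_ac)
qed

text \<open>The dual resolvent identity in tested form. With V the increment and Z =
  \<open>S K'\<close> V one has V = Z - \<open>T K'\<close> Z, so the square of the norm of V
  becomes a pairing of the increments of W and T with Z, whose norm is at most b times that of
  V.\<close>

lemma value_matrices_diff_bound: "norm (value_matrices K' - value_matrices K) \<le> 6 * b^8 * \<delta>"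
proof (cases "value_matrices K' - value_matrices K = 0")
  case False
  let ?V = "value_matrices K' - value_matrices K"
  let ?Z = "S K' ?V"
  have Z: "norm ?Z \<le> b * norm ?V" by (rule S_bound)
  have "?V = ?Z - T K' ?Z" using S_fixpoint[OF st', of ?V] by (metis add_diff_cancel_right')
  then have "?V \<bullet> ?V = ?V \<bullet> (?Z - T K' ?Z)" by simp
  also have "\<dots> = W K' \<bullet> ?Z - value_matrices K \<bullet> (?Z - T K ?Z) + value_matrices K \<bullet> (T K' ?Z - T K ?Z)"
    using inner_value_matrices_residual[OF st', of ?Z] by (simp add: inner_diff_left inner_diff_right)
  also have "\<dots> = (W K' - W K) \<bullet> ?Z + value_matrices K \<bullet> (T K' ?Z - T K ?Z)"
    unfolding inner_value_matrices_residual[OF st] by (simp add: inner_diff_left)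
  also have "\<dots> \<le> norm (W K' - W K) * norm ?Z + norm (value_matrices K) * norm (T K' ?Z - T K ?Z)"
    by (intro add_mono norm_cauchy_schwarz)
  also have "\<dots> \<le> 2 * b^2 * \<delta> * norm ?Z + 2 * b^4 * (2 * b^3 * \<delta> * norm ?Z)"
    using b1 by (intro add_mono mult_mono W_diff_bound value_matrices_bound T_diff_bound order_refl) auto
  also have "\<dots> = (2 * b^2 + 4 * b^7) * \<delta> * norm ?Z" by (simp add: algebra_simps power_numeral_reduce)
  also have "\<dots> \<le> (6 * b^7) * \<delta> * (b * norm ?V)"
    using b1 power_increasing[of 2 7 b] by (intro mult_mono Z) auto
  finally have "norm ?V * norm ?V \<le> (6 * b^8 * \<delta>) * norm ?V"
    by (simp add: dot_square_norm power2_eq_square power_numeral_reduce mult_ac)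
  then show ?thesis using False by (simp only: mult_le_cancel_right) simp
qed (use b1 in simp)

text \<open>The two pairings are telescoped in five steps, one factor at a time; the coefficients 2,
  4, 12, 4, 8 add up to 30.\<close>

lemma dcost_diff_bound: "\<bar>dcost K' H - dcost K H\<bar> \<le> 30 * b^13 * \<delta> * norm H"
proof -
  let ?h = "norm H"
  have "dcost K' H - dcost K H
      = (dW K' H - dW K H) \<bullet> chi K' + dW K H \<bullet> (chi K' - chi K)
        + (value_matrices K' - value_matrices K) \<bullet> dT K' H (chi K') + value_matrices K \<bullet> (dT K' H (chi K') - dT K H (chi K'))
        + value_matrices K \<bullet> dT K H (chi K' - chi K)"
    by (simp add: dcost_def inner_diff_left inner_diff_right dT_def
        linear_diff[OF bounded_linear.linear[OF bounded_linear_jump]])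
  moreover have "\<bar>(dW K' H - dW K H) \<bullet> chi K'\<bar> \<le> 2 * b * ?h * \<delta> * b^2"
    by (rule inner_bound[OF dW_diff_bound chi_bound(2)])
  moreover have "\<bar>dW K H \<bullet> (chi K' - chi K)\<bar> \<le> 2 * b^2 * ?h * (2 * b^6 * \<delta>)"
    by (rule inner_bound[OF dW_bound chi_diff_bound])
  moreover have d': "norm (dT K' H (chi K')) \<le> 2 * b^3 * ?h * b^2"
    by (rule order_trans[OF dT_bound(2) mult_left_mono[OF chi_bound(2)]]) (use b1 in auto)
  moreover have "\<bar>(value_matrices K' - value_matrices K) \<bullet> dT K' H (chi K')\<bar> \<le> 6 * b^8 * \<delta> * (2 * b^3 * ?h * b^2)"
    by (rule inner_bound[OF value_matrices_diff_bound d'])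
  moreover have d1: "norm (dT K' H (chi K') - dT K H (chi K')) \<le> 2 * b^3 * ?h * \<delta> * b^2"
    by (rule order_trans[OF dT_diff_bound mult_left_mono[OF chi_bound(2)]]) (use b1 in auto)
  moreover have "\<bar>value_matrices K \<bullet> (dT K' H (chi K') - dT K H (chi K'))\<bar> \<le> 2 * b^4 * (2 * b^3 * ?h * \<delta> * b^2)"
    by (rule inner_bound[OF value_matrices_bound d1])
  moreover have d2: "norm (dT K H (chi K' - chi K)) \<le> 2 * b^3 * ?h * (2 * b^6 * \<delta>)"
    by (rule order_trans[OF dT_bound(1) mult_left_mono[OF chi_diff_bound]]) (use b1 in auto)
  moreover have "\<bar>value_matrices K \<bullet> dT K H (chi K' - chi K)\<bar> \<le> 2 * b^4 * (2 * b^3 * ?h * (2 * b^6 * \<delta>))"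
    by (rule inner_bound[OF value_matrices_bound d2])
  ultimately have "\<bar>dcost K' H - dcost K H\<bar>
      \<le> 2 * b * ?h * \<delta> * b^2 + 2 * b^2 * ?h * (2 * b^6 * \<delta>) + 6 * b^8 * \<delta> * (2 * b^3 * ?h * b^2)
        + 2 * b^4 * (2 * b^3 * ?h * \<delta> * b^2) + 2 * b^4 * (2 * b^3 * ?h * (2 * b^6 * \<delta>))"
    by linarith
  also have "\<dots> = (2 * b^3 + 4 * b^8 + 20 * b^13 + 4 * b^9) * (\<delta> * ?h)"
    by (simp add: algebra_simps power_numeral_reduce)
  also have "\<dots> \<le> (30 * b^13) * (\<delta> * ?h)"
    using power_increasing[of 3 13 b] power_increasing[of 8 13 b] power_increasing[of 9 13 b] b1
    by (intro mult_right_mono) auto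
  finally show ?thesis by (simp add: mult.assoc)
qed

text \<open>Write the cost of K as its value matrices against \<open>X0\<close>, and
  \<open>X0\<close> as (1 - \<open>T K'\<close>) applied to \<open>chi K'\<close>. Moments of K'
  meet prices of K, which makes the identity exact.\<close>

lemma cost_diff:
  "W K' \<bullet> chi K' - W K \<bullet> chi K = (W K' - W K) \<bullet> chi K' + value_matrices K \<bullet> (T K' (chi K') - T K (chi K'))"
proof -
  have "value_matrices K \<bullet> (chi K' - T K (chi K')) = W K \<bullet> chi K'" by (rule inner_value_matrices_residual[OF st])
  moreover have "value_matrices K \<bullet> X0 = W K \<bullet> chi K" by (simp add: inner_value_matrices[OF st] chi_def)
  moreover have "T K' (chi K') = chi K' - X0"
    using chi_fixpoint[OF st'] by (metis add_diff_cancel_left')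
  ultimately show ?thesis by (simp add: inner_diff_left inner_diff_right)
qed

text \<open>Subtracting \<open>dcost\<close> leaves the second-order remainders of W and T and
  products of two first-order increments, all of order \<delta>^2.\<close>

lemma cost_remainder_bound:
  "\<bar>cost_real K' - cost_real K - dcost K (K' - K)\<bar> \<le> 15 * b^13 * \<delta>^2"
proof -
  let ?H = "K' - K"
  have "cost_real K' - cost_real K - dcost K ?H
      = (W K' - W K - dW K ?H) \<bullet> chi K' + dW K ?H \<bullet> (chi K' - chi K)
        + value_matrices K \<bullet> (T K' (chi K') - T K (chi K') - dT K ?H (chi K')) + value_matrices K \<bullet> dT K ?H (chi K' - chi K)"
    unfolding stable_cost(2)[OF st] stable_cost(2)[OF st'] cost_diff
    by (simp add: dcost_def inner_diff_left inner_diff_right dT_def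
        linear_diff[OF bounded_linear.linear[OF bounded_linear_jump]])
  moreover have "\<bar>(W K' - W K - dW K ?H) \<bullet> chi K'\<bar> \<le> b * \<delta>^2 * b^2"
    by (rule inner_bound[OF W_remainder_bound chi_bound(2)])
  moreover have "\<bar>dW K ?H \<bullet> (chi K' - chi K)\<bar> \<le> 2 * b^2 * \<delta> * (2 * b^6 * \<delta>)"
    by (rule inner_bound[OF dW_bound chi_diff_bound])
  moreover have d1: "norm (T K' (chi K') - T K (chi K') - dT K ?H (chi K')) \<le> b^3 * \<delta>^2 * b^2"
    by (rule order_trans[OF T_remainder_bound mult_left_mono[OF chi_bound(2)]]) (use b1 in auto)
  moreover have "\<bar>value_matrices K \<bullet> (T K' (chi K') - T K (chi K') - dT K ?H (chi K'))\<bar> \<le> 2 * b^4 * (b^3 * \<delta>^2 * b^2)"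
    by (rule inner_bound[OF value_matrices_bound d1])
  moreover have d2: "norm (dT K ?H (chi K' - chi K)) \<le> 2 * b^3 * \<delta> * (2 * b^6 * \<delta>)"
    by (rule order_trans[OF dT_bound(1) mult_left_mono[OF chi_diff_bound]]) (use b1 in auto)
  moreover have "\<bar>value_matrices K \<bullet> dT K ?H (chi K' - chi K)\<bar> \<le> 2 * b^4 * (2 * b^3 * \<delta> * (2 * b^6 * \<delta>))"
    by (rule inner_bound[OF value_matrices_bound d2])
  ultimately have "\<bar>cost_real K' - cost_real K - dcost K ?H\<bar>
      \<le> b * \<delta>^2 * b^2 + 2 * b^2 * \<delta> * (2 * b^6 * \<delta>) + 2 * b^4 * (b^3 * \<delta>^2 * b^2)
        + 2 * b^4 * (2 * b^3 * \<delta> * (2 * b^6 * \<delta>))"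
    by linarith
  also have "\<dots> = (b^3 + 4 * b^8 + 2 * b^9 + 8 * b^13) * \<delta>^2"
    by (simp add: algebra_simps power_numeral_reduce)
  also have "\<dots> \<le> (15 * b^13) * \<delta>^2"
    using power_increasing[of 3 13 b] power_increasing[of 8 13 b] power_increasing[of 9 13 b] b1
    by (intro mult_right_mono) auto
  finally show ?thesis .
qed

lemma grad_diff_bound: "norm (grad K' - grad K) \<le> 30 * b^13 * \<delta>"
proof (cases "grad K' - grad K = 0")
  case False
  let ?V = "grad K' - grad K"
  have "norm ?V * norm ?V = ?V \<bullet> ?V" by (simp add: dot_square_norm power2_eq_square)
  also have "\<dots> = dcost K' ?V - dcost K ?V" by (simp add: inner_diff_right inner_grad)
  also have "\<dots> \<le> 30 * b^13 * \<delta> * norm ?V" using dcost_diff_bound[of ?V] by linarith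
  finally show ?thesis using False by (simp only: mult_le_cancel_right) simp
qed (use b1 in simp)

end

end

subsection \<open>The gradient of the cost\<close>

context mjls_process begin

text \<open>For nonnegative k and s each summand is below the sum. It is affine in k and s, so it
  grows at most linearly when they do.\<close>

definition base_bound :: "real \<Rightarrow> real \<Rightarrow> real" where
  "base_bound k s = 1 + real CARD('d) * s + k + (norm A + real CARD('s) * norm B * k)
    + norm X0 + norm Q + real CARD('s) * norm R + real CARD('s) + real CARD('s) * norm B"

lemma base_bounds:
  assumes k: "norm K \<le> k" and s: "0 \<le> s"
  shows "1 \<le> base_bound k s" "real CARD('d) * s \<le> base_bound k s" "norm K \<le> base_bound k s"
    "norm (closed_loop K) \<le> base_bound k s" "norm X0 \<le> base_bound k s" "norm Q \<le> base_bound k s"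
    "real CARD('s) * norm R \<le> base_bound k s" "real CARD('s) \<le> base_bound k s"
    "real CARD('s) * norm B \<le> base_bound k s"
proof -
  have k0: "0 \<le> k" using k norm_ge_zero order_trans by blast
  have nn: "0 \<le> real CARD('d) * s" "0 \<le> norm A" "0 \<le> real CARD('s) * norm B * k" "0 \<le> norm X0"
    "0 \<le> norm Q" "0 \<le> real CARD('s) * norm R" "0 \<le> real CARD('s)" "0 \<le> real CARD('s) * norm B"
    using s k0 by auto
  show "1 \<le> base_bound k s" "real CARD('d) * s \<le> base_bound k s" "norm K \<le> base_bound k s"
    "norm X0 \<le> base_bound k s" "norm Q \<le> base_bound k s"
    "real CARD('s) * norm R \<le> base_bound k s" "real CARD('s) \<le> base_bound k s"
    "real CARD('s) * norm B \<le> base_bound k s"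
    unfolding base_bound_def using nn k k0 by linarith+
  have "norm (closed_loop K) \<le> norm A + real CARD('s) * norm B * k"
    by (rule order_trans[OF norm_closed_loop_le add_left_mono[OF mult_left_mono[OF k]]]) simp
  then show "norm (closed_loop K) \<le> base_bound k s"
    unfolding base_bound_def using nn k0 by linarith
qed

lemma cost_remainder:
  assumes "stable K s" "stable L s" "norm K \<le> k" "norm L \<le> k" "0 \<le> s"
  shows "\<bar>cost_real L - cost_real K - dcost K (L - K)\<bar> \<le> 15 * base_bound k s ^ 13 * (norm (L - K))\<^sup>2"
  by (rule cost_remainder_bound[OF assms(1,2)]) (rule base_bounds[OF assms(3,5)] base_bounds[OF assms(4,5)])+

lemma grad_lipschitz:
  assumes "stable K s" "stable L s" "norm K \<le> k" "norm L \<le> k" "0 \<le> s"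
  shows "norm (grad L - grad K) \<le> 30 * base_bound k s ^ 13 * norm (L - K)"
  by (rule grad_diff_bound[OF assms(1,2)]) (rule base_bounds[OF assms(3,5)] base_bounds[OF assms(4,5)])+

lemma has_cost_gradient_grad:
  assumes fin: "cost M \<omega> x0 A B Q R K < \<infinity>"
  shows "has_cost_gradient M \<omega> x0 A B Q R K (grad K)"
proof -
  define s where "s = 2 * (cost_real K / Lambda_min Q) / mu D \<pi>"
  obtain \<epsilon> where \<epsilon>: "0 < \<epsilon>" and st: "\<And>L. norm (L - K) < \<epsilon> \<Longrightarrow> stable L s"
    using stable_nbhd[OF finite_cost_stable[OF fin]] s_def by metis
  have s0: "0 \<le> s" using Lambda_pos mu_pos by (simp add: s_def)
  have stK: "stable K s" using st[of K] \<epsilon> by simp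
  have ev: "\<forall>\<^sub>F L in nhds K. cost M \<omega> x0 A B Q R L < \<infinity>"
    unfolding eventually_nhds_metric
  proof (intro exI[of _ \<epsilon>] conjI \<epsilon> allI impI)
    fix L assume "dist L K < \<epsilon>"
    then have "stable L s" by (intro st) (simp add: dist_norm)
    then show "cost M \<omega> x0 A B Q R L < \<infinity>" by (rule stable_cost(1))
  qed
  define c where "c = 15 * base_bound (norm K + 1) s ^ 13"
  have "(cost_real has_derivative (\<lambda>h. h \<bullet> grad K)) (at K)"
  \<comment> \<open>Within \<epsilon> of K the policy L is stable with the same s, and within 1 its
    norm is at most \<open>norm K + 1\<close>; so one constant c serves every L.\<close>
  proof (rule has_derivativeI_sandwich[where e = "min \<epsilon> 1" and H = "\<lambda>L. c * norm (L - K)"])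
    show "0 < min \<epsilon> 1" using \<epsilon> by simp
    show "bounded_linear (\<lambda>h. h \<bullet> grad K)" by (rule bounded_linear_inner_left)
    show "((\<lambda>L. c * norm (L - K)) \<longlongrightarrow> 0) (at K)"
      by (rule tendsto_eq_intros refl | simp)+
  next
    fix L assume "L \<noteq> K" "dist L K < min \<epsilon> 1"
    then have L: "norm (L - K) < \<epsilon>" "norm (L - K) \<le> 1" by (auto simp: dist_norm)
    have "norm L \<le> norm K + 1" using L(2) norm_triangle_sub[of L K] by linarith
    then have "\<bar>cost_real L - cost_real K - dcost K (L - K)\<bar> \<le> c * (norm (L - K))\<^sup>2"
      unfolding c_def by (intro cost_remainder stK st L s0) auto
    then have "norm (cost_real L - cost_real K - (L - K) \<bullet> grad K) \<le> c * norm (L - K) * norm (L - K)"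
      by (simp add: inner_grad power2_eq_square mult.assoc)
    then show "norm (cost_real L - cost_real K - (L - K) \<bullet> grad K) / norm (L - K) \<le> c * norm (L - K)"
      using \<open>L \<noteq> K\<close> by (simp add: pos_divide_le_eq)
  qed
  with ev show ?thesis by (simp add: has_cost_gradient_def gderiv_def)
qed

text \<open>The first radius appears with its denominator cleared, which makes sense also when that
  denominator vanishes. The constant is uniform in K and K' because k and s are bounded by fixed
  multiples of the base of the power.\<close>

lemma grad_locally_lipschitz:
  "\<exists>c. \<forall>K K'. cost M \<omega> x0 A B Q R K < \<infinity> \<longrightarrow>
     4 * cost_real K * (\<Sum>i\<in>UNIV. sigma_max (B $ i) * (sigma_max (A $ i - B $ i ** K $ i) + 1))
       * tuple_norm (K' - K) \<le> Lambda_min Q * mu D \<pi> \<longrightarrow>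
     tuple_norm (K' - K) \<le> (\<Sum>i\<in>UNIV. sigma_max (K $ i)) \<longrightarrow>
     cost M \<omega> x0 A B Q R K' < \<infinity> \<and>
     sigma_max (block_row (grad K' - grad K))
       \<le> c * (1 + tuple_norm K + cost_real K / Lambda_min Q) ^ 13 * tuple_norm (K' - K)"
proof -
  define r where "r = real (CARD('s) * CARD('k) * CARD('d))"
  define k1 where "k1 = r * (1 + real CARD('s))"
  define c0 where "c0 = base_bound k1 (2 / mu D \<pi>)"
  have r0: "0 \<le> r" by (simp add: r_def)
  have k0: "0 \<le> k1" using r0 by (simp add: k1_def)
  have "cost M \<omega> x0 A B Q R K' < \<infinity> \<and> sigma_max (block_row (grad K' - grad K))
       \<le> (30 * r * r * c0 ^ 13) * (1 + tuple_norm K + cost_real K / Lambda_min Q) ^ 13 * tuple_norm (K' - K)"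
    if fin: "cost M \<omega> x0 A B Q R K < \<infinity>" and
    close: "4 * cost_real K * (\<Sum>i\<in>UNIV. sigma_max (B $ i) * (sigma_max (A $ i - B $ i ** K $ i) + 1))
       * tuple_norm (K' - K) \<le> Lambda_min Q * mu D \<pi>" and
    small: "tuple_norm (K' - K) \<le> (\<Sum>i\<in>UNIV. sigma_max (K $ i))" for K K' :: "real^'d^'k^'s"
  proof -
    define x where "x = cost_real K / Lambda_min Q"
    define a where "a = 1 + tuple_norm K + x"
    define s where "s = 2 * x / mu D \<pi>"
    note stK = finite_cost_stable[OF fin]
    have x0: "0 \<le> x" using Lambda_pos by (simp add: x_def)
    have a1: "1 \<le> a" using x0 tuple_norm_nonneg[of K] by (simp add: a_def)
    have s0: "0 \<le> s" using x0 mu_pos by (simp add: s_def)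
    have st': "stable K' s" unfolding s_def x_def by (rule stable_perturbation[OF stK close])
    \<comment> \<open>The neighbourhood lemma is used only at its centre, to give K the same s as
      K'.\<close>
    obtain \<epsilon> where "0 < \<epsilon>" "\<And>L. norm (L - K) < \<epsilon> \<Longrightarrow> stable L s"
      using stable_nbhd[OF stK] s_def x_def by metis
    then have st: "stable K s" by simp
    have "(\<Sum>i\<in>UNIV. sigma_max (K $ i)) \<le> real CARD('s) * tuple_norm K"
      using sum_mono[of UNIV "\<lambda>i. sigma_max (K $ i)" "\<lambda>_. tuple_norm K"] tuple_norm_ge[of K] by simp
    \<comment> \<open>The second radius enters here: the increment, and hence K', is bounded in
      terms of K.\<close>
    then have d: "tuple_norm (K' - K) \<le> real CARD('s) * tuple_norm K" using small by linarith
    have nK: "norm K \<le> r * tuple_norm K" unfolding r_def by (rule norm_le_tuple_norm)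
    have nd: "norm (K' - K) \<le> r * tuple_norm (K' - K)" unfolding r_def by (rule norm_le_tuple_norm)
    have ka: "k1 * tuple_norm K \<le> k1 * a"
      using k0 x0 by (intro mult_left_mono) (auto simp: a_def)
    have "norm K \<le> k1 * tuple_norm K"
      using nK r0 tuple_norm_nonneg[of K] by (simp add: k1_def algebra_simps add_increasing2)
    with ka have K: "norm K \<le> k1 * a" by linarith
    have "norm K' \<le> norm K + norm (K' - K)" by (metis add.commute norm_triangle_sub)
    also have "\<dots> \<le> r * tuple_norm K + r * (real CARD('s) * tuple_norm K)"
      using nK order_trans[OF nd mult_left_mono[OF d r0]] by linarith
    also have "\<dots> = k1 * tuple_norm K" by (simp add: k1_def algebra_simps)
    finally have K': "norm K' \<le> k1 * a" using ka by linarith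
    let ?b = "base_bound (k1 * a) s"
    \<comment> \<open>\<open>base_bound\<close> is affine, its arguments are at most linear in a,
      and its constant terms grow when multiplied by a \<ge> 1.\<close>
    have "?b \<le> c0 * a"
    proof -
      have sa: "s \<le> 2 / mu D \<pi> * a"
        unfolding s_def using mu_pos x0 tuple_norm_nonneg[of K] by (simp add: a_def divide_right_mono)
      have "real CARD('d) * s \<le> real CARD('d) * (2 / mu D \<pi> * a)" using sa by (intro mult_left_mono) auto
      moreover have "y \<le> y * a" if "0 \<le> y" for y using a1 that mult_left_mono by fastforce
      ultimately show ?thesis
        unfolding c0_def base_bound_def distrib_right
        by (intro add_mono) (auto simp: mult.assoc a1)
    qed
    moreover have b0: "0 \<le> ?b" using base_bounds(1)[OF K s0] by simp
    ultimately have b13: "?b ^ 13 \<le> (c0 * a) ^ 13" by (rule power_mono)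
    have "sigma_max (block_row (grad K' - grad K)) \<le> norm (block_row (grad K' - grad K))"
      by (rule sigma_max_le_norm)
    also have "\<dots> \<le> r * norm (grad K' - grad K)" unfolding r_def by (rule norm_block_row)
    also have "\<dots> \<le> r * (30 * ?b ^ 13 * norm (K' - K))"
      by (intro mult_left_mono grad_lipschitz st st' K K' s0 r0)
    also have "\<dots> \<le> r * (30 * (c0 * a) ^ 13 * (r * tuple_norm (K' - K)))"
      using b0 b13 nd r0 order_trans[OF zero_le_power[OF b0] b13]
      by (intro mult_left_mono mult_mono) (auto simp: tuple_norm_nonneg)
    also have "\<dots> = (30 * r * r * c0 ^ 13) * a ^ 13 * tuple_norm (K' - K)"
      by (simp add: power_mult_distrib mult_ac)
    finally show ?thesis using stable_cost(1)[OF st'] by (simp add: a_def x_def)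
  qed
  then show ?thesis by (intro exI[of _ "30 * r * r * c0 ^ 13"]) blast
qed

end

text \<open>For q = 0 the product vanishes and the claim is 0 \<le> p, whatever the quotient; in the
  extended reals a positive p then gives an infinite radius.\<close>

lemma ereal_le_divide_imp:
  fixes t p q :: real
  assumes "ereal t \<le> ereal p / ereal q" "0 \<le> p" "0 \<le> q"
  shows "q * t \<le> p"
  using assms by (cases "q = 0") (auto simp: pos_le_divide_eq mult.commute split: if_splits)

theorem lemma4:
  fixes M :: "'a measure"
    and \<omega> :: "nat \<Rightarrow> 'a \<Rightarrow> 's::finite"
    and x0 :: "'a \<Rightarrow> real^'d"
    and D :: "(real^'d) measure"
    and P :: "real^'s^'s" and \<pi> :: "real^'s"
    and A :: "real^'d^'d^'s" and B :: "real^'k^'d^'s"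
    and Q :: "real^'d^'d^'s" and R :: "real^'k^'k^'s"
  assumes "prob_space M"
    and "markov_chain M \<omega> P \<pi>"
    and "x0 \<in> borel_measurable M" and "distr M borel x0 = D"
    and "prob_space.indep_set M
           (sets (vimage_algebra (space M) x0 borel))
           (sets (vimage_algebra (space M) (\<lambda>a t. \<omega> t a)
                    (Pi\<^sub>M UNIV (\<lambda>_::nat. count_space (UNIV :: 's set)))))"
    and "\<And>i. pos_def (Q $ i)" and "\<And>i. pos_def (R $ i)"
    and "\<And>i. \<pi> $ i > 0"
    and "integrable D (\<lambda>x. (norm x)\<^sup>2)" and "pos_def (second_moment D)"
    and "mean_square_stabilizable M \<omega> A B"
  shows "\<exists>g_diff :: real \<times> real \<times> real \<times> real \<times> real \<times> real \<Rightarrow> real.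
    real_polynomial_function g_diff \<and>
    (\<forall>K K' :: real^'d^'k^'s.
       cost M \<omega> x0 A B Q R K < \<infinity> \<longrightarrow>
       ereal (tuple_norm (K' - K))
         \<le> min (ereal (Lambda_min Q * mu D \<pi>)
                  / ereal (4 * enn2real (cost M \<omega> x0 A B Q R K)
                       * (\<Sum>i\<in>UNIV. sigma_max (B $ i) * (sigma_max (A $ i - B $ i ** K $ i) + 1))))
               (ereal (\<Sum>i\<in>UNIV. sigma_max (K $ i))) \<longrightarrow>
       (\<exists>G G'. has_cost_gradient M \<omega> x0 A B Q R K G \<and>
               has_cost_gradient M \<omega> x0 A B Q R K' G' \<and>
               sigma_max (block_row (G' - G))
                 \<le> g_diff (tuple_norm A, tuple_norm B, tuple_norm Q, tuple_norm R, tuple_norm K,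
                            enn2real (cost M \<omega> x0 A B Q R K) / Lambda_min Q)
                    * tuple_norm (K' - K)))"
proof -
  interpret prob_space M by fact
  interpret mjls_process M P A B Q R \<omega> x0 D \<pi>
    using assms(2-10) by unfold_locales (auto simp: markov_chain_def)
  obtain c where c: "\<And>K K' :: real^'d^'k^'s. cost M \<omega> x0 A B Q R K < \<infinity> \<Longrightarrow>
     4 * cost_real K * (\<Sum>i\<in>UNIV. sigma_max (B $ i) * (sigma_max (A $ i - B $ i ** K $ i) + 1))
       * tuple_norm (K' - K) \<le> Lambda_min Q * mu D \<pi> \<Longrightarrow>
     tuple_norm (K' - K) \<le> (\<Sum>i\<in>UNIV. sigma_max (K $ i)) \<Longrightarrow>
     cost M \<omega> x0 A B Q R K' < \<infinity> \<and>
     sigma_max (block_row (grad K' - grad K))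
       \<le> c * (1 + tuple_norm K + cost_real K / Lambda_min Q) ^ 13 * tuple_norm (K' - K)"
    using grad_locally_lipschitz by blast
  \<comment> \<open>The fifth and sixth components are the norm of K and the cost ratio; the norms
    of A, B, Q, R are fixed with the system, whose contribution sits in c.\<close>
  define g :: "real \<times> real \<times> real \<times> real \<times> real \<times> real \<Rightarrow> real" where
    "g = (\<lambda>z. c * (1 + fst (snd (snd (snd (snd z)))) + snd (snd (snd (snd (snd z))))) ^ 13)"
  have "bounded_linear (\<lambda>z :: real \<times> real \<times> real \<times> real \<times> real \<times> real. fst (snd (snd (snd (snd z)))))"
    "bounded_linear (\<lambda>z :: real \<times> real \<times> real \<times> real \<times> real \<times> real. snd (snd (snd (snd (snd z)))))"
    by (intro bounded_linear_fst_comp bounded_linear_snd_comp bounded_linear_ident)+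
  then have poly: "real_polynomial_function g"
    unfolding g_def
    by (intro real_polynomial_function_power real_polynomial_function.intros)
  show ?thesis
  proof (rule exI[of _ g], intro conjI poly allI impI)
    fix K K' :: "real^'d^'k^'s"
    let ?s = "\<Sum>i\<in>UNIV. sigma_max (B $ i) * (sigma_max (A $ i - B $ i ** K $ i) + 1)"
    assume fin: "cost M \<omega> x0 A B Q R K < \<infinity>"
      and le: "ereal (tuple_norm (K' - K))
         \<le> min (ereal (Lambda_min Q * mu D \<pi>) / ereal (4 * cost_real K * ?s))
               (ereal (\<Sum>i\<in>UNIV. sigma_max (K $ i)))"
    have "0 \<le> ?s" by (intro sum_nonneg mult_nonneg_nonneg add_nonneg_nonneg sigma_max_nonneg) simp
    then have close: "4 * cost_real K * ?s * tuple_norm (K' - K) \<le> Lambda_min Q * mu D \<pi>"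
      using le Lambda_pos mu_pos by (intro ereal_le_divide_imp) auto
    have small: "tuple_norm (K' - K) \<le> (\<Sum>i\<in>UNIV. sigma_max (K $ i))" using le by simp
    from c[OF fin close small] show "\<exists>G G'. has_cost_gradient M \<omega> x0 A B Q R K G \<and>
        has_cost_gradient M \<omega> x0 A B Q R K' G' \<and>
        sigma_max (block_row (G' - G))
          \<le> g (tuple_norm A, tuple_norm B, tuple_norm Q, tuple_norm R, tuple_norm K,
                     cost_real K / Lambda_min Q) * tuple_norm (K' - K)"
      using has_cost_gradient_grad fin by (intro exI[of _ "grad K"] exI[of _ "grad K'"]) (auto simp: g_def)
  qed
qed

end
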